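(* There is a metric space $(M,d)$ with the following properties: (a) $M=\mathbb Z$ and $d$ is the shortest-path distance for a graph on $\mathbb Z$. (b) $M$ is $1$-separated and $\operatorname{diam}M=2$. (c) $\mathcal F(M)$ has the $2$-Schur property but it fails the $c$-Schur property for each $c<2$. (d) $\mathcal F(M)$ has the $1$-strong Schur property.
   Context: All spaces are real. For a metric space $(M,d)$ with a distinguished point $0\in M$, $\operatorname{Lip}_0(M)$ is the Banach space of real-valued Lipschitz functions on $M$ vanishing at $0$, normed by the least Lipschitz constant; for $x\in M$, $\delta(x)\in\operatorname{Lip}_0(M)^*$ is the evaluation $f\mapsto f(x)$; the Lipschitz-free space is $\mathcal F(M)=\overline{\operatorname{span}}\{\delta(x): x\in M\}\subset\operatorname{Lip}_0(M)^*$ (up to isometry independent of the choice of the distinguished point). $M$ is $1$-separated if $d(x,y)\ge1$ for distinct $x,y\in M$. For a bounded sequence in a Banach space $X$ put $\operatorname{ca}(x_n)=\inf_{n}\operatorname{diam}\{x_k: k\ge n\}$ (also for scalar sequences) and $\delta(x_n)=\sup\{\operatorname{ca}(x^*(x_n)): x^*\in B_{X^*}\}$. $X$ has the $c$-Schur property if $\operatorname{ca}(x_n)\le c\,\delta(x_n)$ for each bounded sequence $(x_n)$ in $X$. $X$ has the $1$-strong Schur property if for any $\delta\in(0,2]$, any $\varepsilon>0$ and any normalized $\delta$-separated sequence in $X$ (i.e. $\|x_n\|=1$ and $\|x_n-x_m\|\ge\delta$ for $n\neq m$) there is a subsequence which is $(\frac2\delta+\varepsilon)$-equivalent to the standard basis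 of $\ell_1$; a normalized sequence $(y_j)$ is $K$-equivalent to the standard basis of $\ell_1$ if $\frac1K\sum_{j=1}^m|\alpha_j|\le\|\sum_{j=1}^m\alpha_jy_j\|$ for all $m$ and real $\alpha_1,\dots,\alpha_m$. *)

theory Defs
  imports "HOL-Analysis.Analysis" "HOL-Library.Function_Algebras"
begin

text \<open>
  Real-valued functions form a real vector space under the pointwise operations. A normed space
  is given below by a carrier \<open>X\<close> (a subspace of a real vector space) together
  with a norm \<open>N\<close> on it; the values of \<open>N\<close> outside \<open>X\<close>
  are irrelevant.
\<close>

instantiation "fun" :: (type, real_vector) real_vector
begin

definition scaleR_fun :: "real \<Rightarrow> ('a \<Rightarrow> 'b) \<Rightarrow> 'a \<Rightarrow> 'b"
  where "scaleR_fun c f = (\<lambda>x. c *\<^sub>R f x)"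

instance
  by standard (simp_all add: scaleR_fun_def fun_eq_iff scaleR_add_right scaleR_add_left)

end


subsection \<open>Duals of normed spaces\<close>

text \<open>
  A functional on \<open>X\<close> is represented by a function that vanishes outside
  \<open>X\<close>, so that equality of representatives is equality on \<open>X\<close>.
\<close>

definition dual_space :: "'a::real_vector set \<Rightarrow> ('a \<Rightarrow> real) \<Rightarrow> ('a \<Rightarrow> real) set"
  where "dual_space X N = {\<phi>.
     (\<forall>x\<in>X. \<forall>y\<in>X. \<phi> (x + y) = \<phi> x + \<phi> y) \<and>
     (\<forall>c. \<forall>x\<in>X. \<phi> (c *\<^sub>R x) = c * \<phi> x) \<and>
     (\<exists>B. \<forall>x\<in>X. \<bar>\<phi> x\<bar> \<le> B * N x) \<and>
     (\<forall>x. x \<notin> X \<longrightarrow> \<phi> x = 0)}"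

definition dual_norm :: "'a::real_vector set \<Rightarrow> ('a \<Rightarrow> real) \<Rightarrow> ('a \<Rightarrow> real) \<Rightarrow> real"
  where "dual_norm X N \<phi> = (SUP x\<in>{x \<in> X. N x \<le> 1}. \<bar>\<phi> x\<bar>)"


subsection \<open>Lipschitz-free spaces\<close>

text \<open>
  Here \<open>b\<close> is the distinguished point of \<open>M\<close>. Functions on the carrier
  of \<open>M\<close> are represented by functions that vanish outside it.
\<close>

definition Lip0 :: "'a metric \<Rightarrow> 'a \<Rightarrow> ('a \<Rightarrow> real) set"
  where "Lip0 M b = {f. Lipschitz_continuous_map M euclidean_metric f \<and> f b = 0 \<and>
     (\<forall>x. x \<notin> mspace M \<longrightarrow> f x = 0)}"

definition lip_norm :: "'a metric \<Rightarrow> ('a \<Rightarrow> real) \<Rightarrow> real"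
  where "lip_norm M f =
     Inf {L. 0 \<le> L \<and> (\<forall>x\<in>mspace M. \<forall>y\<in>mspace M. \<bar>f x - f y\<bar> \<le> L * mdist M x y)}"

definition evaluation :: "'a metric \<Rightarrow> 'a \<Rightarrow> 'a \<Rightarrow> ('a \<Rightarrow> real) \<Rightarrow> real"
  where "evaluation M b x = (\<lambda>f. if f \<in> Lip0 M b then f x else 0)"

definition lipfree_norm :: "'a metric \<Rightarrow> 'a \<Rightarrow> (('a \<Rightarrow> real) \<Rightarrow> real) \<Rightarrow> real"
  where "lipfree_norm M b = dual_norm (Lip0 M b) (lip_norm M)"

definition lipfree :: "'a metric \<Rightarrow> 'a \<Rightarrow> (('a \<Rightarrow> real) \<Rightarrow> real) set"
  where "lipfree M b = {\<gamma> \<in> dual_space (Lip0 M b) (lip_norm M).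
     \<forall>\<epsilon>>0. \<exists>\<eta>\<in>span (evaluation M b ` mspace M). lipfree_norm M b (\<gamma> - \<eta>) < \<epsilon>}"


subsection \<open>Quantitative Schur properties\<close>

text \<open>
  The library's \<open>diameter\<close>, for a distance that need not come from a type class.
  As there, the supremum is only meaningful for bounded sets.
\<close>

definition diam_wrt :: "('a \<Rightarrow> 'a \<Rightarrow> real) \<Rightarrow> 'a set \<Rightarrow> real"
  where "diam_wrt d S = (if S = {} then 0 else SUP (x, y)\<in>S \<times> S. d x y)"

lemma diam_wrt_dist: "diam_wrt dist S = diameter S"
  by (simp add: diam_wrt_def diameter_def)

definition ca :: "('a \<Rightarrow> 'a \<Rightarrow> real) \<Rightarrow> (nat \<Rightarrow> 'a) \<Rightarrow> real"
  where "ca d x = (INF n. diam_wrt d (x ` {n..}))"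

definition weak_ca :: "'a::real_vector set \<Rightarrow> ('a \<Rightarrow> real) \<Rightarrow> (nat \<Rightarrow> 'a) \<Rightarrow> real"
  where "weak_ca X N x =
     (SUP \<phi>\<in>{\<phi> \<in> dual_space X N. dual_norm X N \<phi> \<le> 1}. ca dist (\<lambda>n. \<phi> (x n)))"

definition Schur_property :: "'a::real_vector set \<Rightarrow> ('a \<Rightarrow> real) \<Rightarrow> real \<Rightarrow> bool"
  where "Schur_property X N c \<longleftrightarrow>
     (\<forall>x. (\<forall>n. x n \<in> X) \<and> (\<exists>B. \<forall>n. N (x n) \<le> B) \<longrightarrow>
        ca (\<lambda>u v. N (u - v)) x \<le> c * weak_ca X N x)"

text \<open>Only the lower estimate is required; the upper one is automatic for normalized sequences.\<close>

definition equivalent_to_l1_basis ::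
    "('a::real_vector \<Rightarrow> real) \<Rightarrow> real \<Rightarrow> (nat \<Rightarrow> 'a) \<Rightarrow> bool"
  where "equivalent_to_l1_basis N K y \<longleftrightarrow>
     (\<forall>j. N (y j) = 1) \<and>
     (\<forall>m. \<forall>\<alpha>. 1 / K * (\<Sum>j<m. \<bar>\<alpha> j\<bar>) \<le> N (\<Sum>j<m. \<alpha> j *\<^sub>R y j))"

definition one_strong_Schur_property :: "'a::real_vector set \<Rightarrow> ('a \<Rightarrow> real) \<Rightarrow> bool"
  where "one_strong_Schur_property X N \<longleftrightarrow>
     (\<forall>\<delta> \<epsilon> x. 0 < \<delta> \<and> \<delta> \<le> 2 \<and> 0 < \<epsilon> \<and>
        (\<forall>n. x n \<in> X \<and> N (x n) = 1) \<and>
        (\<forall>n m. n \<noteq> m \<longrightarrow> \<delta> \<le> N (x n - x m)) \<longrightarrow>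
        (\<exists>r. strict_mono (r :: nat \<Rightarrow> nat) \<and>
           equivalent_to_l1_basis N (2 / \<delta> + \<epsilon>) (\<lambda>j. x (r j))))"


subsection \<open>Graph distances\<close>

text \<open>
  The edge set of a graph is given as a symmetric irreflexive relation. An element of
  \<open>E ^^ n\<close> is a pair of vertices joined by a walk of length \<open>n\<close>; a
  walk of least length is a path.
\<close>

definition path_distance :: "('a \<times> 'a) set \<Rightarrow> 'a \<Rightarrow> 'a \<Rightarrow> nat"
  where "path_distance E x y = (LEAST n. (x, y) \<in> E ^^ n)"

definition is_graph_metric :: "'a metric \<Rightarrow> bool"
  where "is_graph_metric M \<longleftrightarrow>
     (\<exists>E \<subseteq> mspace M \<times> mspace M. sym E \<and> irrefl E \<and>
        (\<forall>x\<in>mspace M. \<forall>y\<in>mspace M.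
           (x, y) \<in> E\<^sup>* \<and> mdist M x y = real (path_distance E x y)))"

definition one_separated :: "'a metric \<Rightarrow> bool"
  where "one_separated M \<longleftrightarrow>
     (\<forall>x\<in>mspace M. \<forall>y\<in>mspace M. x \<noteq> y \<longrightarrow> 1 \<le> mdist M x y)"

end

theory Submission
  imports Defs "HOL-Complex_Analysis.Great_Picard"
begin

text \<open>
  On the integers let distinct points have distance 1, except that \<open>n\<close> and \<open>-n\<close> have distance 2 for
  \<open>n \<noteq> 0\<close>. This is the shortest-path distance of the graph joining all distinct points that are not
  opposite; paths of length 2 between opposite points pass through \<open>0\<close>.

  The elements of the free space are given by \<open>\<mu> \<in> \<ell>\<^sub>1\<close> of total mass 0 (\<open>act_eq_pairing\<close>), and the norm
  is the maximum of half the \<open>\<ell>\<^sub>1\<close>-norm and of \<open>sup \<bar>\<mu> n - \<mu> (- n)\<bar>\<close>. Indeed a 1-Lipschitz function either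
  oscillates by at most 1, or is, up to a constant, a convex combination of such a function and of one
  with values 1 and -1 at a pair of opposite points and 0 elsewhere (\<open>abs_pairing_antipodal_le\<close>). So the
  norm is equivalent, with constant 2, to half the \<open>\<ell>\<^sub>1\<close>-norm.

  For half the \<open>\<ell>\<^sub>1\<close>-norm a gliding hump argument (\<open>gliding_hump\<close>, \<open>l1_Schur\<close>) shows the Schur property
  with constant 1, which yields the constant 2 for the free space (\<open>lipfree_2_Schur\<close>). For the 1-strong
  Schur property, the second term of the maximum does not contribute to the distance of two almost
  disjoint vectors with symmetric carriers, so the constant for half the \<open>\<ell>\<^sub>1\<close>-norm is preserved
  (\<open>lipfree_1_strong_Schur\<close>). It does contribute to the distance of the evaluations at \<open>n\<close> and \<open>-n\<close>:
  the evaluations at \<open>1, -1, 2, -2, \<dots>\<close> have \<open>ca\<close> equal to 2. But a functional of norm at most 1 is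
  1-Lipschitz on the evaluations, and as soon as it separates one opposite pair by more than 1, it varies by less
  than 1 on the remaining points. So \<open>weak_ca\<close> of this sequence is at most 1
  (\<open>lipfree_not_Schur\<close>).
\<close>

section \<open>Oscillation of sequences at infinity\<close>

lemma ca_le:
  assumes bdd: "\<And>i j. d (x i) (x j) \<le> B" and nonneg: "\<And>i. 0 \<le> d (x i) (x i)"
    and K: "\<And>i j. n \<le> i \<Longrightarrow> n \<le> j \<Longrightarrow> d (x i) (x j) \<le> K"
  shows "ca d x \<le> K"
  unfolding ca_def
proof (rule cINF_lower2)
  show "bdd_below (range (\<lambda>n. diam_wrt d (x ` {n..})))"
  proof (rule bdd_belowI2)
    fix m
    have "d (x m) (x m) \<le> (SUP (u, v)\<in>x ` {m..} \<times> x ` {m..}. d u v)"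
      using cSUP_upper[of "(x m, x m)" "x ` {m..} \<times> x ` {m..}" "\<lambda>(u, v). d u v"] bdd
      by (fastforce intro!: bdd_aboveI2)
    with nonneg[of m] show "0 \<le> diam_wrt d (x ` {m..})" by (simp add: diam_wrt_def)
  qed
  have "(SUP (u, v)\<in>x ` {n..} \<times> x ` {n..}. d u v) \<le> K"
    by (rule cSUP_least) (use K in auto)
  then show "diam_wrt d (x ` {n..}) \<le> K" by (auto simp: diam_wrt_def)
qed simp

lemma ca_ge:
  assumes bdd: "\<And>i j. d (x i) (x j) \<le> B" and K: "\<And>n. \<exists>i\<ge>n. \<exists>j\<ge>n. K \<le> d (x i) (x j)"
  shows "K \<le> ca d x"
  unfolding ca_def
proof (rule cINF_greatest)
  fix n
  obtain i j where "n \<le> i" "n \<le> j" and "K \<le> d (x i) (x j)" using K by blast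
  then have "K \<le> (SUP (u, v)\<in>x ` {n..} \<times> x ` {n..}. d u v)"
    using bdd by (intro cSUP_upper2[of _ _ "(x i, x j)"]) (auto intro!: bdd_aboveI2)
  then show "K \<le> diam_wrt d (x ` {n..})" by (auto simp: diam_wrt_def)
qed simp

lemma less_caD:
  assumes "\<And>i j. d (x i) (x j) \<le> B" "\<And>i. 0 \<le> d (x i) (x i)" "c < ca d x"
  shows "\<exists>i\<ge>n. \<exists>j\<ge>n. c < d (x i) (x j)"
  using ca_le[of d x B n c] assms by (meson not_le)

section \<open>Duality\<close>

lemma dual_spaceI:
  assumes "\<And>x y. x \<in> X \<Longrightarrow> y \<in> X \<Longrightarrow> \<phi> (x + y) = \<phi> x + \<phi> y"
    and "\<And>c x. x \<in> X \<Longrightarrow> \<phi> (c *\<^sub>R x) = c * \<phi> x"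
    and "\<And>x. x \<in> X \<Longrightarrow> \<bar>\<phi> x\<bar> \<le> B * N x"
    and "\<And>x. x \<notin> X \<Longrightarrow> \<phi> x = 0"
  shows "\<phi> \<in> dual_space X N"
  using assms unfolding dual_space_def by blast

lemma dual_spaceD:
  assumes "\<phi> \<in> dual_space X N"
  shows "x \<in> X \<Longrightarrow> y \<in> X \<Longrightarrow> \<phi> (x + y) = \<phi> x + \<phi> y"
    and "x \<in> X \<Longrightarrow> \<phi> (c *\<^sub>R x) = c * \<phi> x"
    and "\<exists>B. \<forall>x\<in>X. \<bar>\<phi> x\<bar> \<le> B * N x"
    and "x \<notin> X \<Longrightarrow> \<phi> x = 0"
  using assms unfolding dual_space_def by blast+

lemma subspace_dual_space: "subspace (dual_space X N)"
proof (rule subspaceI)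
  show "0 \<in> dual_space X N"
    by (rule dual_spaceI[where B = 0]) auto
next
  fix \<phi> \<psi> assume *: "\<phi> \<in> dual_space X N" "\<psi> \<in> dual_space X N"
  obtain B C where "\<And>x. x \<in> X \<Longrightarrow> \<bar>\<phi> x\<bar> \<le> B * N x" "\<And>x. x \<in> X \<Longrightarrow> \<bar>\<psi> x\<bar> \<le> C * N x"
    using *[THEN dual_spaceD(3)] by blast
  then have "\<bar>(\<phi> + \<psi>) x\<bar> \<le> (B + C) * N x" if "x \<in> X" for x
    using that by (force simp: distrib_right intro: order_trans[OF abs_triangle_ineq])
  with * show "\<phi> + \<psi> \<in> dual_space X N"
    by (intro dual_spaceI[where B = "B + C"]) (simp_all add: dual_spaceD algebra_simps)
next
  fix c \<phi> assume *: "\<phi> \<in> dual_space X N"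
  obtain B where "\<And>x. x \<in> X \<Longrightarrow> \<bar>\<phi> x\<bar> \<le> B * N x"
    using *[THEN dual_spaceD(3)] by blast
  then have "\<bar>c * \<phi> x\<bar> \<le> (\<bar>c\<bar> * B) * N x" if "x \<in> X" for x
    using that by (simp add: abs_mult mult.assoc mult_left_mono)
  with * show "c *\<^sub>R \<phi> \<in> dual_space X N"
    by (intro dual_spaceI[where B = "\<bar>c\<bar> * B"])
      (simp_all add: dual_spaceD scaleR_fun_def algebra_simps)
qed

text \<open>
  A subspace with a nonnegative, absolutely homogeneous function on it. The triangle inequality is
  not required: everything below about duality holds without it.
\<close>

locale gauged_space =
  fixes X :: "'a::real_vector set" and N :: "'a \<Rightarrow> real"
  assumes subsp: "subspace X"
    and nonneg: "x \<in> X \<Longrightarrow> 0 \<le> N x"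
    and scale: "x \<in> X \<Longrightarrow> N (c *\<^sub>R x) = \<bar>c\<bar> * N x"
begin

lemma zero_mem: "0 \<in> X" using subsp by (rule subspace_0)

lemma gauge_zero: "N 0 = 0" using scale[OF zero_mem, of 0] by simp

lemma dual_zero:
  assumes "\<phi> \<in> dual_space X N"
  shows "\<phi> 0 = 0"
  using assms zero_mem unfolding dual_space_def by (metis (mono_tags, lifting) mem_Collect_eq mult_zero_left scaleR_zero_left)

lemma dual_diff:
  assumes \<phi>: "\<phi> \<in> dual_space X N" and x: "x \<in> X" and y: "y \<in> X"
  shows "\<phi> (x - y) = \<phi> x - \<phi> y"
proof -
  have "x - y \<in> X" using subspace_diff[OF subsp x y] .
  then have "\<phi> ((x - y) + y) = \<phi> (x - y) + \<phi> y"
    using \<phi> y unfolding dual_space_def by blast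
  then show ?thesis by simp
qed

lemma bdd_above_dual:
  assumes "\<phi> \<in> dual_space X N"
  shows "bdd_above ((\<lambda>x. \<bar>\<phi> x\<bar>) ` {x \<in> X. N x \<le> 1})"
proof -
  obtain B where B: "\<And>x. x \<in> X \<Longrightarrow> \<bar>\<phi> x\<bar> \<le> B * N x"
    using assms unfolding dual_space_def by blast
  have "\<bar>\<phi> x\<bar> \<le> \<bar>B\<bar>" if "x \<in> X" "N x \<le> 1" for x
  proof -
    have "B * N x \<le> \<bar>B\<bar> * 1" using that nonneg by (intro mult_mono) auto
    with B[OF that(1)] show ?thesis by simp
  qed
  then show ?thesis by (auto intro!: bdd_aboveI2)
qed

lemma dual_norm_upper:
  assumes "\<phi> \<in> dual_space X N" "x \<in> X" "N x \<le> 1"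
  shows "\<bar>\<phi> x\<bar> \<le> dual_norm X N \<phi>"
  unfolding dual_norm_def by (rule cSUP_upper) (use assms bdd_above_dual in auto)

lemma dual_norm_least:
  assumes "\<And>x. x \<in> X \<Longrightarrow> N x \<le> 1 \<Longrightarrow> \<bar>\<phi> x\<bar> \<le> K"
  shows "dual_norm X N \<phi> \<le> K"
  unfolding dual_norm_def
  by (rule cSUP_least) (use assms zero_mem gauge_zero in \<open>auto intro!: exI[of _ 0]\<close>)

lemma dual_norm_bound:
  assumes \<phi>: "\<phi> \<in> dual_space X N" and x: "x \<in> X"
  shows "\<bar>\<phi> x\<bar> \<le> dual_norm X N \<phi> * N x"
proof (cases "N x = 0")
  case True
  then show ?thesis using \<phi> x unfolding dual_space_def by fastforce
next
  case False
  then have pos: "0 < N x" using nonneg[OF x] by simp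
  have lin: "\<phi> ((1 / N x) *\<^sub>R x) = 1 / N x * \<phi> x"
    using \<phi> x unfolding dual_space_def by blast
  have "\<bar>\<phi> ((1 / N x) *\<^sub>R x)\<bar> \<le> dual_norm X N \<phi>"
    using pos x subspace_mul[OF subsp x] by (intro dual_norm_upper[OF \<phi>]) (auto simp: scale)
  then show ?thesis using pos unfolding lin by (simp add: abs_mult field_simps)
qed

lemma dual_norm_nonneg:
  assumes "\<phi> \<in> dual_space X N"
  shows "0 \<le> dual_norm X N \<phi>"
  using dual_norm_upper[OF assms zero_mem] gauge_zero by simp

lemma dual_norm_add:
  assumes "\<phi> \<in> dual_space X N" "\<psi> \<in> dual_space X N"
  shows "dual_norm X N (\<phi> + \<psi>) \<le> dual_norm X N \<phi> + dual_norm X N \<psi>"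
proof (rule dual_norm_least)
  fix x assume "x \<in> X" "N x \<le> 1"
  with assms[THEN dual_norm_upper, of x] show "\<bar>(\<phi> + \<psi>) x\<bar> \<le> dual_norm X N \<phi> + dual_norm X N \<psi>"
    by simp
qed

lemma dual_norm_scale:
  assumes \<phi>: "\<phi> \<in> dual_space X N"
  shows "dual_norm X N (c *\<^sub>R \<phi>) = \<bar>c\<bar> * dual_norm X N \<phi>"
proof -
  have le: "dual_norm X N (c *\<^sub>R \<phi>) \<le> \<bar>c\<bar> * dual_norm X N \<phi>" if "\<phi> \<in> dual_space X N" for c \<phi>
    by (rule dual_norm_least)
      (use dual_norm_upper[OF that] in \<open>auto simp: scaleR_fun_def abs_mult intro!: mult_left_mono\<close>)
  show ?thesis
  proof (cases "c = 0")
    case True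
    have "dual_norm X N 0 \<le> 0" by (rule dual_norm_least) simp
    with True dual_norm_nonneg[OF subspace_0[OF subspace_dual_space]] show ?thesis by auto
  next
    case False
    have "dual_norm X N ((1 / c) *\<^sub>R (c *\<^sub>R \<phi>)) \<le> \<bar>1 / c\<bar> * dual_norm X N (c *\<^sub>R \<phi>)"
      by (rule le) (rule subspace_mul[OF subspace_dual_space \<phi>])
    then have "\<bar>c\<bar> * dual_norm X N \<phi> \<le> dual_norm X N (c *\<^sub>R \<phi>)"
      using False by (simp add: field_simps abs_divide)
    with le[OF \<phi>, of c] show ?thesis by simp
  qed
qed

lemma gauged_dual: "gauged_space (dual_space X N) (dual_norm X N)"
  by unfold_locales (use subspace_dual_space dual_norm_nonneg dual_norm_scale in auto)

lemma ca_le_weak_ca: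
  assumes x: "\<And>n. x n \<in> X" and B: "\<And>n. N (x n) \<le> B"
    and \<phi>: "\<phi> \<in> dual_space X N" "dual_norm X N \<phi> \<le> 1"
  shows "ca dist (\<lambda>n. \<phi> (x n)) \<le> weak_ca X N x"
  unfolding weak_ca_def
proof (rule cSUP_upper)
  have "ca dist (\<lambda>n. \<psi> (x n)) \<le> 2 * B" if \<psi>: "\<psi> \<in> dual_space X N" "dual_norm X N \<psi> \<le> 1" for \<psi>
  proof -
    have b: "\<bar>\<psi> (x n)\<bar> \<le> B" for n
    proof -
      have "dual_norm X N \<psi> * N (x n) \<le> 1 * N (x n)"
        using \<psi>(2) nonneg[OF x] by (rule mult_right_mono)
      with dual_norm_bound[OF \<psi>(1) x, of n] B[of n] show ?thesis by simp
    qed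
    have le: "dist (\<psi> (x i)) (\<psi> (x j)) \<le> 2 * B" for i j
      using b[of i] b[of j] by (simp add: dist_real_def)
    show ?thesis by (rule ca_le[where n = 0 and B = "2 * B"]) (use le in auto)
  qed
  then show "bdd_above ((\<lambda>\<psi>. ca dist (\<lambda>n. \<psi> (x n))) ` {\<psi> \<in> dual_space X N. dual_norm X N \<psi> \<le> 1})"
    by (auto intro!: bdd_aboveI2)
qed (use \<phi> in auto)

lemma weak_ca_nonneg:
  assumes "\<And>n. x n \<in> X" "\<And>n. N (x n) \<le> B"
  shows "0 \<le> weak_ca X N x"
proof -
  have "0 \<le> ca dist (\<lambda>n::nat. (0 :: 'a \<Rightarrow> real) (x n))" by (rule ca_ge) auto
  also have "\<dots> \<le> weak_ca X N x"
    using assms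
    by (rule ca_le_weak_ca) (rule subspace_0[OF subspace_dual_space], rule dual_norm_least, simp)
  finally show ?thesis .
qed

lemma weak_ca_least:
  assumes "\<And>\<phi>. \<phi> \<in> dual_space X N \<Longrightarrow> dual_norm X N \<phi> \<le> 1 \<Longrightarrow> ca dist (\<lambda>n. \<phi> (x n)) \<le> K"
  shows "weak_ca X N x \<le> K"
proof -
  have "dual_norm X N 0 \<le> 1" by (rule dual_norm_least) simp
  then show ?thesis
    unfolding weak_ca_def using assms subspace_0[OF subspace_dual_space[of X N]]
    by (intro cSUP_least) auto
qed

end

section \<open>Lipschitz-free spaces\<close>

lemma lip_norm_le:
  assumes "0 \<le> L" "\<And>x y. x \<in> mspace M \<Longrightarrow> y \<in> mspace M \<Longrightarrow> \<bar>f x - f y\<bar> \<le> L * mdist M x y"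
  shows "lip_norm M f \<le> L"
  unfolding lip_norm_def by (rule cInf_lower) (use assms in \<open>auto intro!: bdd_belowI[of _ 0]\<close>)

lemma Lip0_iff:
  "f \<in> Lip0 M b \<longleftrightarrow> (\<exists>L\<ge>0. \<forall>x\<in>mspace M. \<forall>y\<in>mspace M. \<bar>f x - f y\<bar> \<le> L * mdist M x y) \<and>
     f b = 0 \<and> (\<forall>x. x \<notin> mspace M \<longrightarrow> f x = 0)"
proof -
  have "\<exists>L\<ge>0. \<forall>x\<in>mspace M. \<forall>y\<in>mspace M. \<bar>f x - f y\<bar> \<le> L * mdist M x y"
    if "\<forall>x\<in>mspace M. \<forall>y\<in>mspace M. \<bar>f x - f y\<bar> \<le> L * mdist M x y" for L
  proof (intro exI[of _ "\<bar>L\<bar>"] conjI ballI)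
    fix x y assume "x \<in> mspace M" "y \<in> mspace M"
    then have "\<bar>f x - f y\<bar> \<le> L * mdist M x y" using that by blast
    also have "\<dots> \<le> \<bar>L\<bar> * mdist M x y" by (rule mult_right_mono) auto
    finally show "\<bar>f x - f y\<bar> \<le> \<bar>L\<bar> * mdist M x y" .
  qed simp
  then show ?thesis
    by (auto simp: Lip0_def Lipschitz_continuous_map_def dist_real_def)
qed

lemma lip_norm_nonneg:
  assumes "f \<in> Lip0 M b"
  shows "0 \<le> lip_norm M f"
  unfolding lip_norm_def by (rule cInf_greatest) (use assms in \<open>auto simp: Lip0_iff\<close>)

lemma lip_norm_bound:
  assumes f: "f \<in> Lip0 M b" and xy: "x \<in> mspace M" "y \<in> mspace M"
  shows "\<bar>f x - f y\<bar> \<le> lip_norm M f * mdist M x y"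
proof (cases "x = y")
  case True
  then show ?thesis using mdist_zero[OF xy(2) xy(2)] by simp
next
  case False
  then have pos: "0 < mdist M x y" using mdist_zero[OF xy] mdist_nonneg[of M x y] by linarith
  have "\<bar>f x - f y\<bar> / mdist M x y \<le> lip_norm M f"
    unfolding lip_norm_def
    by (rule cInf_greatest) (use f xy pos in \<open>auto simp: Lip0_iff field_simps\<close>)
  then show ?thesis using pos by (simp add: field_simps)
qed

lemma subspace_Lip0: "subspace (Lip0 M b)"
proof (rule subspaceI)
  show "0 \<in> Lip0 M b" by (auto simp: Lip0_iff intro!: exI[of _ 0])
next
  fix f g assume *: "f \<in> Lip0 M b" "g \<in> Lip0 M b"
  have "\<bar>(f + g) x - (f + g) y\<bar> \<le> (lip_norm M f + lip_norm M g) * mdist M x y"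
    if "x \<in> mspace M" "y \<in> mspace M" for x y
    using lip_norm_bound[OF *(1) that] lip_norm_bound[OF *(2) that] by (simp add: distrib_right)
  moreover have "0 \<le> lip_norm M f + lip_norm M g" using *[THEN lip_norm_nonneg] by simp
  ultimately show "f + g \<in> Lip0 M b" using * unfolding Lip0_iff by auto
next
  fix c f assume *: "f \<in> Lip0 M b"
  have "\<bar>(c *\<^sub>R f) x - (c *\<^sub>R f) y\<bar> \<le> (\<bar>c\<bar> * lip_norm M f) * mdist M x y"
    if "x \<in> mspace M" "y \<in> mspace M" for x y
    using mult_left_mono[OF lip_norm_bound[OF * that], of "\<bar>c\<bar>"]
    by (simp add: scaleR_fun_def mult.assoc flip: abs_mult right_diff_distrib)
  moreover have "0 \<le> \<bar>c\<bar> * lip_norm M f" using lip_norm_nonneg[OF *] by simp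
  ultimately show "c *\<^sub>R f \<in> Lip0 M b" using * unfolding Lip0_iff by (auto simp: scaleR_fun_def)
qed

lemma gauged_Lip0: "gauged_space (Lip0 M b) (lip_norm M)"
proof
  fix c f assume f: "f \<in> Lip0 M b"
  have le: "lip_norm M (c *\<^sub>R f) \<le> \<bar>c\<bar> * lip_norm M f" if f: "f \<in> Lip0 M b" for c f
  proof (rule lip_norm_le)
    show "0 \<le> \<bar>c\<bar> * lip_norm M f" using lip_norm_nonneg[OF f] by simp
    show "\<bar>(c *\<^sub>R f) x - (c *\<^sub>R f) y\<bar> \<le> \<bar>c\<bar> * lip_norm M f * mdist M x y"
      if "x \<in> mspace M" "y \<in> mspace M" for x y
      using mult_left_mono[OF lip_norm_bound[OF f that], of "\<bar>c\<bar>"]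
      by (simp add: scaleR_fun_def mult.assoc flip: abs_mult right_diff_distrib)
  qed
  show "lip_norm M (c *\<^sub>R f) = \<bar>c\<bar> * lip_norm M f"
  proof (cases "c = 0")
    case True
    have "lip_norm M 0 \<le> 0" by (rule lip_norm_le) auto
    with True lip_norm_nonneg[OF subspace_0[OF subspace_Lip0], of M] show ?thesis by simp
  next
    case False
    have "lip_norm M ((1 / c) *\<^sub>R (c *\<^sub>R f)) \<le> \<bar>1 / c\<bar> * lip_norm M (c *\<^sub>R f)"
      by (rule le) (rule subspace_mul[OF subspace_Lip0 f])
    then have "\<bar>c\<bar> * lip_norm M f \<le> lip_norm M (c *\<^sub>R f)"
      using False by (simp add: field_simps abs_divide)
    with le[OF f, of c] show ?thesis by simp
  qed
qed (fact subspace_Lip0, fact lip_norm_nonneg)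

interpretation Lip0: gauged_space "Lip0 M b" "lip_norm M" for M b
  by (rule gauged_Lip0)

interpretation Lip0_dual: gauged_space "dual_space (Lip0 M b) (lip_norm M)" "lipfree_norm M b" for M b
  unfolding lipfree_norm_def by (rule Lip0.gauged_dual)

lemma evaluation_in_dual:
  assumes b: "b \<in> mspace M" and p: "p \<in> mspace M"
  shows "evaluation M b p \<in> dual_space (Lip0 M b) (lip_norm M)"
proof -
  have "\<bar>f p\<bar> \<le> mdist M p b * lip_norm M f" if "f \<in> Lip0 M b" for f
    using lip_norm_bound[OF that p b] that by (simp add: Lip0_iff mult.commute)
  moreover have "(c *\<^sub>R f) p = c * f p" for c and f :: "'a \<Rightarrow> real"
    by (simp add: scaleR_fun_def)
  ultimately show ?thesis
    by (intro dual_spaceI[where B = "mdist M p b"])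
      (simp_all add: evaluation_def subspace_add[OF subspace_Lip0] subspace_mul[OF subspace_Lip0])
qed

lemma lipfree_subset_dual: "lipfree M b \<subseteq> dual_space (Lip0 M b) (lip_norm M)"
  by (auto simp: lipfree_def)

lemma span_evaluation_subset_dual:
  assumes "b \<in> mspace M"
  shows "span (evaluation M b ` mspace M) \<subseteq> dual_space (Lip0 M b) (lip_norm M)"
  by (rule span_minimal) (use evaluation_in_dual assms subspace_dual_space in auto)

lemma lipfree_norm_add:
  assumes "\<gamma> \<in> dual_space (Lip0 M b) (lip_norm M)" "\<eta> \<in> dual_space (Lip0 M b) (lip_norm M)"
  shows "lipfree_norm M b (\<gamma> + \<eta>) \<le> lipfree_norm M b \<gamma> + lipfree_norm M b \<eta>"
  using assms unfolding lipfree_norm_def by (rule Lip0.dual_norm_add)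

lemma span_evaluation_subset_lipfree:
  assumes "b \<in> mspace M"
  shows "span (evaluation M b ` mspace M) \<subseteq> lipfree M b"
proof
  fix \<eta> assume "\<eta> \<in> span (evaluation M b ` mspace M)"
  moreover from this have "\<eta> \<in> dual_space (Lip0 M b) (lip_norm M)"
    using span_evaluation_subset_dual[OF assms] by blast
  moreover have "lipfree_norm M b (\<eta> - \<eta>) = 0"
    by (simp add: Lip0_dual.gauge_zero)
  ultimately show "\<eta> \<in> lipfree M b"
    unfolding lipfree_def by force
qed

lemma subspace_lipfree:
  assumes b: "b \<in> mspace M"
  shows "subspace (lipfree M b)"
proof (rule subspaceI)
  show "0 \<in> lipfree M b" using span_evaluation_subset_lipfree[OF b] span_zero by blast
next
  fix \<gamma> \<gamma>' assume *: "\<gamma> \<in> lipfree M b" "\<gamma>' \<in> lipfree M b"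
  note dual = subsetD[OF lipfree_subset_dual] subsetD[OF span_evaluation_subset_dual[OF b]]
  show "\<gamma> + \<gamma>' \<in> lipfree M b"
    unfolding lipfree_def
  proof (intro CollectI conjI allI impI)
    show "\<gamma> + \<gamma>' \<in> dual_space (Lip0 M b) (lip_norm M)"
      by (intro subspace_add[OF subspace_dual_space] dual *)
    fix \<epsilon> :: real assume "0 < \<epsilon>"
    then have "0 < \<epsilon> / 2" by simp
    then obtain \<eta> \<eta>' where
      e: "\<eta> \<in> span (evaluation M b ` mspace M)" "lipfree_norm M b (\<gamma> - \<eta>) < \<epsilon> / 2"
        "\<eta>' \<in> span (evaluation M b ` mspace M)" "lipfree_norm M b (\<gamma>' - \<eta>') < \<epsilon> / 2"
      using * unfolding lipfree_def by blast
    have "lipfree_norm M b ((\<gamma> - \<eta>) + (\<gamma>' - \<eta>')) \<le> lipfree_norm M b (\<gamma> - \<eta>) + lipfree_norm M b (\<gamma>' - \<eta>')"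
      by (intro lipfree_norm_add subspace_diff[OF subspace_dual_space] dual * e)
    moreover have "(\<gamma> - \<eta>) + (\<gamma>' - \<eta>') = (\<gamma> + \<gamma>') - (\<eta> + \<eta>')" by simp
    ultimately have "lipfree_norm M b ((\<gamma> + \<gamma>') - (\<eta> + \<eta>')) < \<epsilon>"
      using e by simp
    then show "\<exists>\<eta>\<in>span (evaluation M b ` mspace M). lipfree_norm M b (\<gamma> + \<gamma>' - \<eta>) < \<epsilon>"
      using e span_add by blast
  qed
next
  fix c \<gamma> assume *: "\<gamma> \<in> lipfree M b"
  note dual = subsetD[OF lipfree_subset_dual *] subsetD[OF span_evaluation_subset_dual[OF b]]
  show "c *\<^sub>R \<gamma> \<in> lipfree M b"
    unfolding lipfree_def
  proof (intro CollectI conjI allI impI)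
    show "c *\<^sub>R \<gamma> \<in> dual_space (Lip0 M b) (lip_norm M)"
      by (intro subspace_mul[OF subspace_dual_space] dual)
    fix \<epsilon> :: real assume "0 < \<epsilon>"
    then have "0 < \<epsilon> / (\<bar>c\<bar> + 1)" by simp
    then obtain \<eta> where
      e: "\<eta> \<in> span (evaluation M b ` mspace M)" "lipfree_norm M b (\<gamma> - \<eta>) < \<epsilon> / (\<bar>c\<bar> + 1)"
      using * unfolding lipfree_def by blast
    have d: "\<gamma> - \<eta> \<in> dual_space (Lip0 M b) (lip_norm M)"
      by (intro subspace_diff[OF subspace_dual_space] dual e)
    have "lipfree_norm M b (c *\<^sub>R \<gamma> - c *\<^sub>R \<eta>) = \<bar>c\<bar> * lipfree_norm M b (\<gamma> - \<eta>)"
      using Lip0_dual.scale[OF d, of c] by (simp add: scaleR_diff_right)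
    also have "\<dots> \<le> (\<bar>c\<bar> + 1) * lipfree_norm M b (\<gamma> - \<eta>)"
      using Lip0_dual.nonneg[OF d] by (intro mult_right_mono) auto
    also have "\<dots> < \<epsilon>"
      using e(2) by (simp add: field_simps add_pos_nonneg)
    finally show "\<exists>\<eta>\<in>span (evaluation M b ` mspace M). lipfree_norm M b (c *\<^sub>R \<gamma> - \<eta>) < \<epsilon>"
      using e span_mul by blast
  qed
qed

lemma gauged_lipfree:
  assumes "b \<in> mspace M"
  shows "gauged_space (lipfree M b) (lipfree_norm M b)"
proof
  show "subspace (lipfree M b)" using assms by (rule subspace_lipfree)
  fix \<gamma> c assume "\<gamma> \<in> lipfree M b"
  then have "\<gamma> \<in> dual_space (Lip0 M b) (lip_norm M)" by (rule subsetD[OF lipfree_subset_dual])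
  then show "0 \<le> lipfree_norm M b \<gamma>" "lipfree_norm M b (c *\<^sub>R \<gamma>) = \<bar>c\<bar> * lipfree_norm M b \<gamma>"
    by (fact Lip0_dual.nonneg Lip0_dual.scale)+
qed

lemma abs_le_lipfree_norm:
  assumes "\<gamma> \<in> dual_space (Lip0 M b) (lip_norm M)" "f \<in> Lip0 M b" "lip_norm M f \<le> 1"
  shows "\<bar>\<gamma> f\<bar> \<le> lipfree_norm M b \<gamma>"
  using assms unfolding lipfree_norm_def by (rule Lip0.dual_norm_upper)

text \<open>
  Lipschitz functions act on the free space as functionals of norm at most one. This suffices for
  lower bounds of \<open>weak_ca\<close>; that every functional arises in this way is not needed.
\<close>

lemma lipfree_ca_le_weak_ca:
  assumes b: "b \<in> mspace M" and f: "f \<in> Lip0 M b" "lip_norm M f \<le> 1"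
    and x: "\<And>n. x n \<in> lipfree M b" and B: "\<And>n. lipfree_norm M b (x n) \<le> B"
  shows "ca dist (\<lambda>n. x n f) \<le> weak_ca (lipfree M b) (lipfree_norm M b) x"
proof -
  interpret gauged_space "lipfree M b" "lipfree_norm M b" using b by (rule gauged_lipfree)
  define \<phi> where "\<phi> \<gamma> = (if \<gamma> \<in> lipfree M b then \<gamma> f else 0)" for \<gamma>
  have le: "\<bar>\<phi> \<gamma>\<bar> \<le> lipfree_norm M b \<gamma>" if "\<gamma> \<in> lipfree M b" for \<gamma>
    using abs_le_lipfree_norm[OF subsetD[OF lipfree_subset_dual that] f] that by (simp add: \<phi>_def)
  have "\<phi> \<in> dual_space (lipfree M b) (lipfree_norm M b)"
  proof (rule dual_spaceI[where B = 1])
    show "\<phi> (c *\<^sub>R \<gamma>) = c * \<phi> \<gamma>" if "\<gamma> \<in> lipfree M b" for c \<gamma>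
      using that subspace_mul[OF subsp that, of c] by (simp add: \<phi>_def) (simp add: scaleR_fun_def)
  qed (use le subspace_add[OF subsp] in \<open>auto simp: \<phi>_def\<close>)
  moreover have "dual_norm (lipfree M b) (lipfree_norm M b) \<phi> \<le> 1"
    by (rule dual_norm_least) (use le in force)
  ultimately have "ca dist (\<lambda>n. \<phi> (x n)) \<le> weak_ca (lipfree M b) (lipfree_norm M b) x"
    by (intro ca_le_weak_ca[OF x B])
  then show ?thesis by (simp add: \<phi>_def x)
qed

section \<open>Sequences in the space of absolutely summable families\<close>

text \<open>
  The \<open>\<ell>\<^sub>1\<close>-norm of the restriction of \<open>\<mu>\<close> to \<open>S\<close>. For real families, summability over
  \<open>UNIV\<close> is the same as absolute summability, so \<open>\<mu> summable_on UNIV\<close> expresses membership in \<open>\<ell>\<^sub>1\<close>.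
\<close>

definition l1_on :: "'a set \<Rightarrow> ('a \<Rightarrow> real) \<Rightarrow> real"
  where "l1_on S \<mu> = (\<Sum>\<^sub>\<infinity>n\<in>S. \<bar>\<mu> n\<bar>)"

text \<open>
  The duality between \<open>\<ell>\<^sub>1\<close> and the bounded functions.
\<close>

definition pairing :: "('a \<Rightarrow> real) \<Rightarrow> ('a \<Rightarrow> real) \<Rightarrow> real"
  where "pairing \<mu> f = (\<Sum>\<^sub>\<infinity>n. \<mu> n * f n)"

lemma abs_summable_on_subset:
  fixes \<mu> :: "'a \<Rightarrow> real"
  assumes "\<mu> summable_on UNIV"
  shows "(\<lambda>n. \<bar>\<mu> n\<bar>) summable_on S"
  using assms summable_on_subset_banach[of \<mu> UNIV S] summable_on_iff_abs_summable_on_real[of \<mu> S]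
  by simp

lemma summable_on_mult_bounded:
  fixes \<mu> :: "'a \<Rightarrow> real"
  assumes "\<mu> summable_on UNIV" "\<And>n. \<bar>f n\<bar> \<le> B"
  shows "(\<lambda>n. \<mu> n * f n) summable_on S"
proof -
  have "(\<lambda>n. B * \<mu> n) summable_on S"
    using assms(1) by (intro summable_on_cmult_right) (rule summable_on_subset_banach, auto)
  then have "(\<lambda>n. norm (B * \<mu> n)) summable_on S"
    by (rule summable_on_iff_abs_summable_on_real[THEN iffD1])
  moreover have "norm (\<mu> n * f n) \<le> norm (B * \<mu> n)" for n
  proof -
    have "\<bar>f n\<bar> \<le> \<bar>B\<bar>" using assms(2)[of n] by linarith
    then have "\<bar>\<mu> n\<bar> * \<bar>f n\<bar> \<le> \<bar>\<mu> n\<bar> * \<bar>B\<bar>" by (rule mult_left_mono) simp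
    then show ?thesis by (simp add: abs_mult mult.commute)
  qed
  ultimately have "(\<lambda>n. norm (\<mu> n * f n)) summable_on S"
    by (rule Infinite_Sum.abs_summable_on_comparison_test)
  then show ?thesis
    by (rule abs_summable_summable)
qed

lemma l1_on_nonneg: "0 \<le> l1_on S \<mu>"
  unfolding l1_on_def by (rule infsum_nonneg) simp

lemma l1_on_mono:
  assumes "\<mu> summable_on UNIV" "S \<subseteq> T"
  shows "l1_on S \<mu> \<le> l1_on T \<mu>"
  unfolding l1_on_def by (rule infsum_mono2) (use assms abs_summable_on_subset in auto)

lemma l1_on_Compl:
  assumes "\<mu> summable_on UNIV"
  shows "l1_on UNIV \<mu> = l1_on S \<mu> + l1_on (- S) \<mu>"
  unfolding l1_on_def
  using infsum_Un_disjoint[OF abs_summable_on_subset[OF assms, of S] abs_summable_on_subset[OF assms, of "- S"]]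
  by simp

lemma l1_on_diff_le:
  assumes "\<mu> summable_on UNIV" "\<nu> summable_on UNIV"
  shows "l1_on S (\<lambda>n. \<mu> n - \<nu> n) \<le> l1_on S \<mu> + l1_on S \<nu>"
proof -
  have s: "(\<lambda>n. \<mu> n - \<nu> n) summable_on UNIV"
    using summable_on_add[OF assms(1) summable_on_uminus[THEN iffD2, OF assms(2)]] by simp
  show ?thesis
    unfolding l1_on_def
    by (subst infsum_add[symmetric])
      (use assms s in \<open>auto intro!: infsum_mono abs_summable_on_subset summable_on_add\<close>)
qed

lemma abs_le_l1_on:
  assumes "\<mu> summable_on UNIV" "n \<in> S"
  shows "\<bar>\<mu> n\<bar> \<le> l1_on S \<mu>"
  unfolding l1_on_def
  using finite_sum_le_infsum[OF abs_summable_on_subset[OF assms(1), of S], of "{n}"] assms by simp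

lemma abs_add_abs_le_l1_on:
  assumes "\<mu> summable_on UNIV" "n \<in> S" "m \<in> S" "n \<noteq> m"
  shows "\<bar>\<mu> n\<bar> + \<bar>\<mu> m\<bar> \<le> l1_on S \<mu>"
  unfolding l1_on_def
  using finite_sum_le_infsum[OF abs_summable_on_subset[OF assms(1), of S], of "{n, m}"] assms by simp

lemma pairing_add_left:
  assumes "\<mu> summable_on UNIV" "\<nu> summable_on UNIV" "\<And>n. \<bar>f n\<bar> \<le> B"
  shows "pairing (\<lambda>n. \<mu> n + \<nu> n) f = pairing \<mu> f + pairing \<nu> f"
  unfolding pairing_def distrib_right
  by (rule infsum_add) (use assms in \<open>auto intro: summable_on_mult_bounded\<close>)

lemma pairing_add_right:
  assumes "\<mu> summable_on UNIV" "\<And>n. \<bar>f n\<bar> \<le> B" "\<And>n. \<bar>g n\<bar> \<le> C"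
  shows "pairing \<mu> (\<lambda>n. f n + g n) = pairing \<mu> f + pairing \<mu> g"
  unfolding pairing_def distrib_left
  by (rule infsum_add) (use assms in \<open>auto intro: summable_on_mult_bounded\<close>)

lemma pairing_cmult_right: "pairing \<mu> (\<lambda>n. c * f n) = c * pairing \<mu> f"
  unfolding pairing_def by (subst infsum_cmult_right'[symmetric]) (simp add: ac_simps)

lemma abs_pairing_le:
  assumes \<mu>: "\<mu> summable_on UNIV" and f: "\<And>n. \<bar>f n\<bar> \<le> B" and "\<And>n. n \<notin> S \<Longrightarrow> f n = 0"
  shows "\<bar>pairing \<mu> f\<bar> \<le> B * l1_on S \<mu>"
proof -
  have a: "(\<lambda>n. norm (\<mu> n * f n)) summable_on UNIV"
    by (rule summable_on_iff_abs_summable_on_real[THEN iffD1])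
      (rule summable_on_mult_bounded[OF \<mu> f])
  have "\<bar>pairing \<mu> f\<bar> \<le> (\<Sum>\<^sub>\<infinity>n. \<bar>\<mu> n * f n\<bar>)"
    unfolding pairing_def using norm_infsum_bound[OF a] by simp
  also have "\<dots> \<le> (\<Sum>\<^sub>\<infinity>n\<in>S. B * \<bar>\<mu> n\<bar>)"
  proof (rule infsum_mono_neutral)
    show "(\<lambda>n. \<bar>\<mu> n * f n\<bar>) summable_on UNIV" using a by simp
    show "(\<lambda>n. B * \<bar>\<mu> n\<bar>) summable_on S"
      using \<mu> by (intro summable_on_cmult_right abs_summable_on_subset)
    show le: "\<bar>\<mu> n * f n\<bar> \<le> B * \<bar>\<mu> n\<bar>" for n
      using mult_right_mono[OF f[of n], of "\<bar>\<mu> n\<bar>"] by (simp add: abs_mult mult.commute)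
  qed (use assms(3) in auto)
  also have "\<dots> = B * l1_on S \<mu>"
    unfolding l1_on_def by (rule infsum_cmult_right')
  finally show ?thesis .
qed

text \<open>
  A function with values in \<open>[-1/2, 1/2]\<close> that has the signs of \<open>\<mu>\<close> on \<open>S\<close> nearly attains half the norm
  of \<open>\<mu>\<close> if \<open>\<mu>\<close> is concentrated on \<open>S\<close>: outside \<open>S\<close> each point loses at most \<open>\<bar>\<mu> n\<bar>\<close>.
\<close>

lemma pairing_ge_half_l1:
  assumes \<mu>: "\<mu> summable_on UNIV" and f: "\<And>n. \<bar>f n\<bar> \<le> 1/2"
    and S: "\<And>n. n \<in> S \<Longrightarrow> f n = sgn (\<mu> n) / 2"
  shows "l1_on UNIV \<mu> / 2 - l1_on (- S) \<mu> \<le> pairing \<mu> f"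
proof -
  have 1: "(\<lambda>n. 1/2 * \<bar>\<mu> n\<bar>) summable_on UNIV"
    using \<mu> by (intro summable_on_cmult_right abs_summable_on_subset)
  have 2: "(\<lambda>n. - (\<mu> n * f n)) summable_on UNIV"
    using summable_on_mult_bounded[of \<mu> f "1/2" UNIV] \<mu> f by (simp add: summable_on_uminus)
  have "l1_on UNIV \<mu> / 2 - pairing \<mu> f = (\<Sum>\<^sub>\<infinity>n. 1/2 * \<bar>\<mu> n\<bar> + - (\<mu> n * f n))"
    unfolding l1_on_def pairing_def infsum_add[OF 1 2] infsum_uminus infsum_cmult_right' by simp
  also have "\<dots> \<le> (\<Sum>\<^sub>\<infinity>n\<in>-S. \<bar>\<mu> n\<bar>)"
  proof (rule infsum_mono_neutral)
    show "(\<lambda>n. 1/2 * \<bar>\<mu> n\<bar> + - (\<mu> n * f n)) summable_on UNIV"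
      by (rule summable_on_add[OF 1 2])
    show "(\<lambda>n. \<bar>\<mu> n\<bar>) summable_on - S" using \<mu> by (rule abs_summable_on_subset)
    show "1/2 * \<bar>\<mu> n\<bar> + - (\<mu> n * f n) \<le> \<bar>\<mu> n\<bar>" for n
    proof -
      have "\<bar>\<mu> n * f n\<bar> \<le> \<bar>\<mu> n\<bar> * (1/2)"
        unfolding abs_mult by (rule mult_left_mono) (use f in auto)
      then show ?thesis by linarith
    qed
    show "1/2 * \<bar>\<mu> n\<bar> + - (\<mu> n * f n) \<le> 0" if "n \<in> UNIV - - S" for n
    proof -
      have "f n = sgn (\<mu> n) / 2" using that by (intro S) auto
      then show ?thesis by (cases "\<mu> n" "0::real" rule: linorder_cases) auto
    qed
  qed auto
  finally show ?thesis unfolding l1_on_def by simp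
qed

lemma l1_on_tail_small:
  fixes \<mu> :: "int \<Rightarrow> real"
  assumes \<mu>: "\<mu> summable_on UNIV" and "0 < \<epsilon>"
  shows "\<exists>N\<ge>K. l1_on (- {-N..N}) \<mu> \<le> \<epsilon>"
proof -
  obtain F where F: "finite F" "dist (\<Sum>n\<in>F. \<bar>\<mu> n\<bar>) (l1_on UNIV \<mu>) \<le> \<epsilon>"
    unfolding l1_on_def
    using infsum_finite_approximation[OF abs_summable_on_subset[OF \<mu>, of UNIV] \<open>0 < \<epsilon>\<close>] by auto
  define N where "N = Max (insert K (abs ` F))"
  have N: "K \<le> N" "\<And>n. n \<in> F \<Longrightarrow> \<bar>n\<bar> \<le> N"
    unfolding N_def using F(1) by auto
  then have "F \<subseteq> {-N..N}" by (fastforce simp: abs_le_iff)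
  then have "l1_on (- {-N..N}) \<mu> \<le> l1_on (- F) \<mu>"
    using \<mu> by (intro l1_on_mono) auto
  also have "\<dots> = l1_on UNIV \<mu> - (\<Sum>n\<in>F. \<bar>\<mu> n\<bar>)"
    using l1_on_Compl[OF \<mu>, of F] F(1) by (simp add: l1_on_def)
  also have "\<dots> \<le> \<epsilon>" using F(2) by (simp add: dist_real_def)
  finally show ?thesis using N(1) by blast
qed

lemma coordinatewise_limit_summable:
  assumes x: "\<And>k. x k summable_on UNIV" and B: "\<And>k::nat. l1_on UNIV (x k) \<le> B"
    and lim: "\<And>n. (\<lambda>k. x k n) \<longlonglongrightarrow> u n"
  shows "u summable_on UNIV"
proof -
  have "(\<Sum>n\<in>F. \<bar>u n\<bar>) \<le> B" if "finite F" for F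
  proof (rule LIMSEQ_le_const2)
    show "(\<lambda>k. \<Sum>n\<in>F. \<bar>x k n\<bar>) \<longlonglongrightarrow> (\<Sum>n\<in>F. \<bar>u n\<bar>)"
      by (intro tendsto_sum tendsto_rabs lim)
    have "(\<Sum>n\<in>F. \<bar>x k n\<bar>) \<le> B" for k
      using finite_sum_le_infsum[OF abs_summable_on_subset[OF x[of k], of UNIV] that] B[of k]
      by (simp add: l1_on_def)
    then show "\<exists>K. \<forall>k\<ge>K. (\<Sum>n\<in>F. \<bar>x k n\<bar>) \<le> B" by blast
  qed
  then have "(\<lambda>n. norm (u n)) summable_on UNIV"
    unfolding abs_summable_iff_bdd_above by (auto intro!: bdd_aboveI2)
  then show ?thesis using summable_on_iff_abs_summable_on_real by blast
qed

text \<open>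
  After passing to a subsequence, a bounded sequence in \<open>\<ell>\<^sub>1\<close> is a fixed vector \<open>u\<close>, carried up to
  \<open>\<epsilon>\<close> by \<open>F0\<close>, plus vectors of almost constant norm \<open>a\<close> that are carried up to \<open>\<epsilon>\<close> by disjoint blocks
  \<open>G j\<close>. One fixed \<open>\<epsilon>\<close> suffices in the applications, because the errors are always weighted by the
  coefficients of a linear combination. The blocks are differences of intervals around \<open>0\<close>, hence
  symmetric; this matters because the metric singles out the pairs \<open>{n, -n}\<close>.
\<close>

lemma gliding_hump:
  fixes x :: "nat \<Rightarrow> int \<Rightarrow> real"
  assumes x: "\<And>k. x k summable_on UNIV" and B: "\<And>k. l1_on UNIV (x k) \<le> B" and \<epsilon>: "0 < \<epsilon>"
  obtains r u F0 G a where "strict_mono (r :: nat \<Rightarrow> nat)" "u summable_on UNIV"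
    "l1_on (- F0) u \<le> \<epsilon>"
    "\<And>j. G j \<inter> F0 = {}" "disjoint_family G"
    "\<And>j n. n \<in> G j \<Longrightarrow> - n \<in> G j"
    "\<And>j. l1_on (- G (j::nat)) (\<lambda>n. x (r j) n - u n) \<le> \<epsilon>"
    "\<And>j. \<bar>l1_on UNIV (\<lambda>n. x (r j) n - u n) - a\<bar> \<le> \<epsilon>"
proof -
  have "\<exists>k. strict_mono (k::nat\<Rightarrow>nat) \<and> (\<forall>n\<in>UNIV. \<exists>l. (\<lambda>j. x (k j) n) \<longlonglongrightarrow> l)"
  proof -
    have b: "norm (x k n) \<le> B" for k n
      using abs_le_l1_on[OF x[of k], of n UNIV] B[of k] by simp
    show ?thesis
      by (rule function_convergent_subsequence[of "UNIV :: int set" x B]) (use b in auto)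
  qed
  then obtain k1 u where k1: "strict_mono k1" and u: "\<And>n. (\<lambda>j. x (k1 j) n) \<longlonglongrightarrow> u n"
    by (metis UNIV_I)
  have us: "u summable_on UNIV"
    by (rule coordinatewise_limit_summable[of "\<lambda>j. x (k1 j)" B]) (use x B u in auto)
  define y where "y k n = x (k1 k) n - u n" for k n
  have ys: "y k summable_on UNIV" for k
    unfolding y_def
    using summable_on_add[OF x[of "k1 k"] summable_on_uminus[THEN iffD2, OF us]] by simp
  have yB: "l1_on UNIV (y k) \<le> B + l1_on UNIV u" for k
    unfolding y_def using l1_on_diff_le[OF x[of "k1 k"] us, of UNIV] B[of "k1 k"] by simp
  have "\<bar>l1_on UNIV (y k)\<bar> \<le> B + l1_on UNIV u" for k
    using yB[of k] l1_on_nonneg[of UNIV "y k"] by linarith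
  then have "bounded (range (\<lambda>k. l1_on UNIV (y k)))"
    by (intro boundedI[of _ "B + l1_on UNIV u"]) auto
  then obtain a k2 where k2: "strict_mono (k2::nat\<Rightarrow>nat)" and a: "(\<lambda>j. l1_on UNIV (y (k2 j))) \<longlonglongrightarrow> a"
    using bounded_imp_convergent_subsequence[of "\<lambda>k. l1_on UNIV (y k)"] by (auto simp: o_def)
  define z where "z j = y (k2 j)" for j
  have zs: "z j summable_on UNIV" for j by (simp add: z_def ys)
  have zx: "z j = (\<lambda>n. x (k1 (k2 j)) n - u n)" for j by (simp add: z_def y_def fun_eq_iff)
  have z0: "(\<lambda>j. z j n) \<longlonglongrightarrow> 0" for n
  proof -
    have "(\<lambda>j. x (k1 (k2 j)) n - u n) \<longlonglongrightarrow> u n - u n"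
      using LIMSEQ_subseq_LIMSEQ[OF u k2] by (intro tendsto_diff tendsto_const) (simp add: o_def)
    then show ?thesis by (simp add: zx)
  qed
  have ev_a: "\<forall>\<^sub>F j in sequentially. \<bar>l1_on UNIV (z j) - a\<bar> \<le> \<epsilon>"
    using tendstoD[OF a \<epsilon>] by (auto simp: dist_real_def z_def elim: eventually_mono)
  have ev_F: "\<forall>\<^sub>F j in sequentially. l1_on {-N..N} (z j) \<le> \<epsilon> / 2" for N
  proof -
    have "(\<lambda>j. \<Sum>n\<in>{-N..N}. \<bar>z j n\<bar>) \<longlonglongrightarrow> (\<Sum>n\<in>{-N..N}. \<bar>0\<bar>)"
      by (intro tendsto_sum tendsto_rabs z0)
    then have "(\<lambda>j. l1_on {-N..N} (z j)) \<longlonglongrightarrow> 0" by (simp add: l1_on_def)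
    from tendstoD[OF this, of "\<epsilon>/2"] \<epsilon> show ?thesis
      by (auto simp: dist_real_def elim!: eventually_mono)
  qed
  obtain N0 where N0: "l1_on (- {-N0..N0}) u \<le> \<epsilon>"
    using l1_on_tail_small[OF us \<epsilon>] by blast
  \<comment> \<open>A stage \<open>(k, N, N')\<close> records the index of a term and the two radii bounding its block.\<close>
  define P where "P = (\<lambda>s. case s of (k, N, N') \<Rightarrow> N0 \<le> N \<and> N \<le> N' \<and>
      \<bar>l1_on UNIV (z k) - a\<bar> \<le> \<epsilon> \<and> l1_on {-N..N} (z k) \<le> \<epsilon> / 2 \<and> l1_on (- {-N'..N'}) (z k) \<le> \<epsilon> / 2)"
  have ex: "\<exists>k N'. m < k \<and> P (k, N, N')" if "N0 \<le> N" for N m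
  proof -
    have "\<forall>\<^sub>F k in sequentially. m < k \<and> \<bar>l1_on UNIV (z k) - a\<bar> \<le> \<epsilon> \<and> l1_on {-N..N} (z k) \<le> \<epsilon> / 2"
      by (intro eventually_conj ev_a ev_F eventually_gt_at_top)
    then obtain k where k: "m < k" "\<bar>l1_on UNIV (z k) - a\<bar> \<le> \<epsilon>" "l1_on {-N..N} (z k) \<le> \<epsilon> / 2"
      using eventually_happens'[OF sequentially_bot] by blast
    obtain N' where "N' \<ge> N" "l1_on (- {-N'..N'}) (z k) \<le> \<epsilon> / 2"
      using l1_on_tail_small[OF zs, of "\<epsilon>/2"] \<epsilon> by auto
    with k that show ?thesis unfolding P_def by auto
  qed
  have "\<exists>f. \<forall>n. P (f n) \<and> (fst (f n) < fst (f (Suc n)) \<and> fst (snd (f (Suc n))) = snd (snd (f n)))"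
  proof (rule dependent_nat_choice)
    show "\<exists>s. P s" using ex[of N0] by blast
  next
    fix s :: "nat \<times> int \<times> int" and n :: nat
    assume "P s"
    moreover obtain k N N' where s: "s = (k, N, N')" by (cases s) auto
    ultimately have "N0 \<le> N'" by (simp add: P_def)
    from ex[OF this, of k] obtain k' N'' where "k < k'" "P (k', N', N'')" by blast
    then show "\<exists>t. P t \<and> fst s < fst t \<and> fst (snd t) = snd (snd s)"
      by (intro exI[of _ "(k', N', N'')"]) (simp add: s)
  qed
  then obtain f where f: "\<And>n. P (f n)" "\<And>n. fst (f n) < fst (f (Suc n))"
    "\<And>n. fst (snd (f (Suc n))) = snd (snd (f n))" by blast
  define k where "k j = fst (f j)" for j
  define N where "N j = fst (snd (f j))" for j
  have Pj: "P (k j, N j, N (Suc j))" for j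
    using f(1)[of j] f(3)[of j] by (simp add: k_def N_def)
  have kmono: "strict_mono k" unfolding strict_mono_Suc_iff k_def using f(2) by simp
  have Nmono: "mono N" unfolding mono_iff_le_Suc using Pj by (auto simp: P_def)
  define G where "G j = {-N (Suc j)..N (Suc j)} - {-N j..N j}" for j
  show thesis
  proof
    show "strict_mono (k1 \<circ> k2 \<circ> k)" using k1 k2 kmono by (intro strict_mono_o)
    show "u summable_on UNIV" by fact
    show "l1_on (- {-N0..N0}) u \<le> \<epsilon>" by fact
    show "G j \<inter> {-N0..N0} = {}" for j
      using Pj[of j] unfolding G_def P_def by auto
    show "- n \<in> G j" if "n \<in> G j" for j n using that unfolding G_def by auto
    show "disjoint_family G"
      unfolding disjoint_family_on_def
    proof (intro ballI impI)
      fix i j :: nat assume "i \<noteq> j"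
      have "G i \<inter> G j = {}" if "i < j" for i j
        using monoD[OF Nmono, of "Suc i" j] that unfolding G_def by auto
      then show "G i \<inter> G j = {}" using \<open>i \<noteq> j\<close> by (metis inf_commute linorder_neqE_nat)
    qed
    show "l1_on (- G j) (\<lambda>n. x ((k1 \<circ> k2 \<circ> k) j) n - u n) \<le> \<epsilon>" for j
    proof -
      let ?z = "z (k j)"
      let ?I = "{-N j..N j}" and ?J = "{-N (Suc j)..N (Suc j)}"
      have "l1_on (- G j) ?z \<le> l1_on (?I \<union> - ?J) ?z"
        by (intro l1_on_mono zs) (auto simp: G_def)
      also have "\<dots> = l1_on ?I ?z + l1_on (- ?J) ?z"
        unfolding l1_on_def
        by (rule infsum_Un_disjoint)
          (use abs_summable_on_subset[OF zs] monoD[OF Nmono, of j "Suc j"] in auto)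
      also have "\<dots> \<le> \<epsilon>" using Pj[of j] by (simp add: P_def)
      finally show ?thesis by (simp add: zx)
    qed
    show "\<bar>l1_on UNIV (\<lambda>n. x ((k1 \<circ> k2 \<circ> k) j) n - u n) - a\<bar> \<le> \<epsilon>" for j
      using Pj[of j] by (simp add: P_def zx)
  qed
qed

lemma sign_pattern:
  fixes w :: "'a \<Rightarrow> real" and v :: "'i \<Rightarrow> 'a \<Rightarrow> real"
  assumes disj: "disjoint_family G" and F: "\<And>j. G j \<inter> F0 = {}"
    and v: "\<And>j n. \<bar>v j n\<bar> \<le> 1" and w: "\<And>n. \<bar>w n\<bar> \<le> 1"
  shows "\<exists>f. (\<forall>n. \<bar>f n\<bar> \<le> 1 / 2) \<and> (\<forall>j. \<forall>n\<in>G j. f n = v j n / 2) \<and> (\<forall>n\<in>F0. f n = w n / 2)"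
proof -
  define f where "f n = (if n \<in> F0 then w n / 2
      else if \<exists>j. n \<in> G j then v (THE j. n \<in> G j) n / 2 else 0)" for n
  show ?thesis
  proof (intro exI[of _ f] conjI allI ballI)
    show "\<bar>f n\<bar> \<le> 1 / 2" for n using v w by (auto simp: f_def)
    show "f n = w n / 2" if "n \<in> F0" for n using that by (simp add: f_def)
    show "f n = v j n / 2" if "n \<in> G j" for j n
    proof -
      have "(THE j. n \<in> G j) = j" using that disj unfolding disjoint_family_on_def by (intro the_equality) blast+
      with that F[of j] show ?thesis by (auto simp: f_def)
    qed
  qed
qed

text \<open>
  Half the \<open>\<ell>\<^sub>1\<close>-norm is attained, up to \<open>\<epsilon>\<close> and along a subsequence, by a single function with values in
  \<open>[-1/2, 1/2]\<close>. Such functions have oscillation at most 1 and are therefore 1-Lipschitz on every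
  1-separated space.
\<close>

lemma l1_Schur:
  fixes x :: "nat \<Rightarrow> int \<Rightarrow> real"
  assumes x: "\<And>k. x k summable_on UNIV" and B: "\<And>k. l1_on UNIV (x k) \<le> B"
    and c: "\<And>k. c \<le> l1_on UNIV (x k)" and \<epsilon>: "0 < \<epsilon>"
  obtains f r where "\<And>n. \<bar>f n\<bar> \<le> 1 / 2" "strict_mono (r :: nat \<Rightarrow> nat)"
    "\<And>k. c / 2 - \<epsilon> \<le> pairing (x (r k)) f"
proof -
  have "0 < \<epsilon> / 2" using \<epsilon> by simp
  then obtain r u F0 G a where r: "strict_mono (r :: nat \<Rightarrow> nat)" and u: "u summable_on UNIV"
    and F0: "l1_on (- F0) u \<le> \<epsilon> / 2"
    and GF: "\<And>j. G j \<inter> F0 = {}" and G: "disjoint_family G"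
    and "\<And>j n. n \<in> G j \<Longrightarrow> - n \<in> G j"
    and y: "\<And>j. l1_on (- G (j::nat)) (\<lambda>n. x (r j) n - u n) \<le> \<epsilon> / 2"
    and "\<And>j. \<bar>l1_on UNIV (\<lambda>n. x (r j) n - u n) - a\<bar> \<le> \<epsilon> / 2"
    by (rule gliding_hump[of x B "\<epsilon> / 2", OF x B]) blast
  define y where "y = (\<lambda>j n. x (r j) n - u n)"
  have ys: "y j summable_on UNIV" for j
    unfolding y_def
    using summable_on_add[OF x[of "r j"] summable_on_uminus[THEN iffD2, OF u]] by simp
  have sgn: "\<bar>sgn t\<bar> \<le> 1" for t :: real by (simp add: abs_sgn_eq)
  obtain f where "\<forall>n. \<bar>f n\<bar> \<le> 1 / 2" "\<forall>j. \<forall>n\<in>G j. f n = sgn (y j n) / 2"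
    "\<forall>n\<in>F0. f n = sgn (u n) / 2"
    using sign_pattern[of G F0 "\<lambda>j n. sgn (y j n)" "\<lambda>n. sgn (u n)", OF G GF sgn sgn] by blast
  then have f: "\<And>n. \<bar>f n\<bar> \<le> 1 / 2" and fG: "\<And>j n. n \<in> G j \<Longrightarrow> f n = sgn (y j n) / 2"
    and fF: "\<And>n. n \<in> F0 \<Longrightarrow> f n = sgn (u n) / 2" by auto
  show thesis
  proof
    show "c / 2 - \<epsilon> \<le> pairing (x (r k)) f" for k
    proof -
      have xk: "x (r k) = (\<lambda>n. u n + y k n)" by (simp add: y_def)
      have "c \<le> l1_on UNIV u + l1_on UNIV (y k)"
      proof -
        have "x (r k) = (\<lambda>n. u n - (- y k n))" by (simp add: y_def)
        then have "l1_on UNIV (x (r k)) \<le> l1_on UNIV u + l1_on UNIV (\<lambda>n. - y k n)"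
          using l1_on_diff_le[OF u summable_on_uminus[THEN iffD2, OF ys], of UNIV k] by simp
        then show ?thesis using c[of "r k"] by (simp add: l1_on_def)
      qed
      moreover have "l1_on UNIV u / 2 - \<epsilon> / 2 \<le> pairing u f"
        using pairing_ge_half_l1[OF u, of f F0, OF f fF] F0 by simp
      moreover have "l1_on UNIV (y k) / 2 - \<epsilon> / 2 \<le> pairing (y k) f"
        using pairing_ge_half_l1[OF ys, of f "G k" k, OF f fG] y[of k] by (simp add: y_def)
      moreover have "pairing (x (r k)) f = pairing u f + pairing (y k) f"
        unfolding xk by (rule pairing_add_left[OF u ys, where B = "1 / 2", OF f])
      ultimately show ?thesis by simp
    qed
  qed (fact f r)+
qed

section \<open>The antipodal metric\<close>

text \<open>
  The graph joins any two distinct integers that are not opposite to each other. The vertex \<open>0\<close> is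
  its own opposite, hence adjacent to all others, so \<open>n\<close> and \<open>-n\<close> have distance 2 for \<open>n \<noteq> 0\<close>.
\<close>

definition antipodal_dist :: "int \<Rightarrow> int \<Rightarrow> real"
  where "antipodal_dist m n = (if m = n then 0 else if m = - n then 2 else 1)"

definition antipodal_metric :: "int metric"
  where "antipodal_metric = metric (UNIV, antipodal_dist)"

lemma Metric_space_antipodal: "Metric_space UNIV antipodal_dist"
  by unfold_locales (auto simp: antipodal_dist_def)

lemma mspace_antipodal [simp]: "mspace antipodal_metric = UNIV"
  unfolding antipodal_metric_def by (rule Metric_space.mspace_metric[OF Metric_space_antipodal])

lemma mdist_antipodal [simp]: "mdist antipodal_metric = antipodal_dist"
  unfolding antipodal_metric_def by (rule Metric_space.mdist_metric[OF Metric_space_antipodal])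

lemma is_graph_metric_antipodal: "is_graph_metric antipodal_metric"
  unfolding is_graph_metric_def
proof (intro exI conjI ballI)
  let ?E = "{(x, y). x \<noteq> y \<and> x \<noteq> - y} :: (int \<times> int) set"
  show "?E \<subseteq> mspace antipodal_metric \<times> mspace antipodal_metric" by simp
  show "sym ?E" "irrefl ?E" by (auto simp: sym_def irrefl_def)
  fix x y :: int
  consider "x = y" | "x \<noteq> y" "x = - y" | "(x, y) \<in> ?E" by blast
  then have "(x, y) \<in> ?E\<^sup>* \<and> antipodal_dist x y = real (path_distance ?E x y)"
  proof cases
    case 1
    have "path_distance ?E x y = 0"
      unfolding path_distance_def by (rule Least_equality) (use 1 in auto)
    with 1 show ?thesis by (simp add: antipodal_dist_def)
  next
    case 2
    \<comment> \<open>The vertex \<open>0\<close> is adjacent to every other one.\<close>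
    have e: "(x, 0) \<in> ?E" "(0, y) \<in> ?E" using 2 by auto
    then have "(x, y) \<in> ?E ^^ 2" unfolding numeral_2_eq_2 by auto
    moreover have "2 \<le> k" if "(x, y) \<in> ?E ^^ k" for k
    proof (rule ccontr)
      assume "\<not> 2 \<le> k"
      then have "k = 0 \<or> k = 1" by auto
      with that 2 show False by auto
    qed
    ultimately have "path_distance ?E x y = 2"
      unfolding path_distance_def by (intro Least_equality)
    moreover have "(x, y) \<in> ?E\<^sup>*" using e by (meson r_into_rtrancl rtrancl_trans)
    ultimately show ?thesis using 2 by (simp add: antipodal_dist_def)
  next
    case 3
    have "path_distance ?E x y = 1"
      unfolding path_distance_def
    proof (rule Least_equality)
      show "1 \<le> k" if "(x, y) \<in> ?E ^^ k" for k using that 3 by (cases k) auto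
    qed (use 3 in auto)
    with 3 show ?thesis by (auto simp: antipodal_dist_def)
  qed
  then show "(x, y) \<in> ?E\<^sup>*" "mdist antipodal_metric x y = real (path_distance ?E x y)" by simp_all
qed

lemma antipodal_dist_le_2: "antipodal_dist m n \<le> 2"
  by (simp add: antipodal_dist_def)

lemma bounded_oscillation_imp_Lip0:
  assumes "\<And>m n. \<bar>f m - f n\<bar> \<le> L"
  shows "(\<lambda>n. f n - f b) \<in> Lip0 antipodal_metric b"
    and "lip_norm antipodal_metric (\<lambda>n. f n - f b) \<le> L"
proof -
  have L: "0 \<le> L" using assms[of 0 0] by simp
  then have "\<bar>f m - f n\<bar> \<le> L * antipodal_dist m n" for m n
    using assms[of m n] by (auto simp: antipodal_dist_def)
  with L show "(\<lambda>n. f n - f b) \<in> Lip0 antipodal_metric b"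
    "lip_norm antipodal_metric (\<lambda>n. f n - f b) \<le> L"
    by (auto simp: Lip0_iff intro!: lip_norm_le)
qed

section \<open>Elements of the free space as summable families\<close>

text \<open>
  An element of the free space with base point \<open>b\<close> acts on every bounded function, after subtraction
  of the value at \<open>b\<close>. In this form constants are annihilated and the point \<open>b\<close> plays no special
  role.
\<close>

definition act :: "int \<Rightarrow> ((int \<Rightarrow> real) \<Rightarrow> real) \<Rightarrow> (int \<Rightarrow> real) \<Rightarrow> real"
  where "act b \<gamma> f = \<gamma> (\<lambda>n. f n - f b)"

text \<open>
  The coefficient of \<open>\<gamma>\<close> at the point \<open>n\<close>. For elements of the free space, the coefficient at the
  base point is minus the sum of all others, so the total mass is 0.
\<close>

definition mass :: "int \<Rightarrow> ((int \<Rightarrow> real) \<Rightarrow> real) \<Rightarrow> int \<Rightarrow> real"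
  where "mass b \<gamma> n = act b \<gamma> (\<lambda>m. of_bool (m = n))"

text \<open>
  The free space over the metric above with its norm, and the dual of the Lipschitz functions in
  which it lies, for an arbitrary base point.
\<close>

abbreviation "FM b \<equiv> lipfree antipodal_metric b"
abbreviation "FN b \<equiv> lipfree_norm antipodal_metric b"
abbreviation "FD b \<equiv> dual_space (Lip0 antipodal_metric b) (lip_norm antipodal_metric)"

interpretation FM: gauged_space "FM b" "FN b" for b
  by (rule gauged_lipfree) simp

lemma FM_FD: "\<gamma> \<in> FM b \<Longrightarrow> \<gamma> \<in> FD b"
  by (rule subsetD[OF lipfree_subset_dual])

lemma bounded_imp_oscillation:
  fixes f :: "'a \<Rightarrow> real"
  assumes "\<And>n. \<bar>f n\<bar> \<le> B"
  shows "\<bar>f m - f n\<bar> \<le> 2 * B"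
  using assms[of m] assms[of n] by linarith

lemma bounded_imp_Lip0:
  assumes f: "\<And>n. \<bar>f n\<bar> \<le> B"
  shows "(\<lambda>n. f n - f b) \<in> Lip0 antipodal_metric b"
  by (rule bounded_oscillation_imp_Lip0(1)[where L = "2 * B"]) (rule bounded_imp_oscillation[OF f])

lemma abs_act_le:
  assumes \<gamma>: "\<gamma> \<in> FD b" and L: "\<And>m n. \<bar>f m - f n\<bar> \<le> L"
  shows "\<bar>act b \<gamma> f\<bar> \<le> FN b \<gamma> * L"
proof -
  let ?g = "\<lambda>n. f n - f b"
  have "\<bar>\<gamma> ?g\<bar> \<le> FN b \<gamma> * lip_norm antipodal_metric ?g"
    unfolding lipfree_norm_def
    by (rule Lip0.dual_norm_bound[OF \<gamma> bounded_oscillation_imp_Lip0(1)[of f L, OF L]])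
  also have "\<dots> \<le> FN b \<gamma> * L"
    by (intro mult_left_mono bounded_oscillation_imp_Lip0(2)[of f L, OF L] Lip0_dual.nonneg[OF \<gamma>])
  finally show ?thesis by (simp add: act_def)
qed

lemma act_add:
  assumes \<gamma>: "\<gamma> \<in> FD b" and f: "\<And>n. \<bar>f n\<bar> \<le> B" and g: "\<And>n. \<bar>g n\<bar> \<le> C"
  shows "act b \<gamma> (\<lambda>n. f n + g n) = act b \<gamma> f + act b \<gamma> g"
proof -
  have "(\<lambda>n. f n + g n - (f b + g b)) = (\<lambda>n. f n - f b) + (\<lambda>n. g n - g b)"
    by (auto simp: fun_eq_iff)
  moreover have "(\<lambda>n. f n - f b) \<in> Lip0 antipodal_metric b" "(\<lambda>n. g n - g b) \<in> Lip0 antipodal_metric b"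
    using bounded_imp_Lip0[of f B, OF f] bounded_imp_Lip0[of g C, OF g] by blast+
  ultimately show ?thesis
    unfolding act_def by (simp only: dual_spaceD(1)[OF \<gamma>])
qed

lemma act_cmult:
  assumes \<gamma>: "\<gamma> \<in> FD b" and f: "\<And>n. \<bar>f n\<bar> \<le> B"
  shows "act b \<gamma> (\<lambda>n. c * f n) = c * act b \<gamma> f"
proof -
  have "(\<lambda>n. c * f n - c * f b) = c *\<^sub>R (\<lambda>n. f n - f b)"
    by (auto simp: fun_eq_iff scaleR_fun_def right_diff_distrib)
  moreover have "(\<lambda>n. f n - f b) \<in> Lip0 antipodal_metric b"
    using bounded_imp_Lip0[of f B, OF f] .
  ultimately show ?thesis
    unfolding act_def by (simp only: dual_spaceD(2)[OF \<gamma>])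
qed

lemma act_finite_support:
  assumes \<gamma>: "\<gamma> \<in> FD b" and "finite F"
  shows "act b \<gamma> (\<lambda>m. if m \<in> F then c m else 0) = (\<Sum>n\<in>F. mass b \<gamma> n * c n)"
  using \<open>finite F\<close>
proof (induction F rule: finite_induct)
  case empty
  have "act b \<gamma> (\<lambda>_. 0 * 0) = 0 * act b \<gamma> (\<lambda>_. 0)" by (rule act_cmult[OF \<gamma>, of _ 0]) simp
  then show ?case by simp
next
  case (insert a F)
  have b1: "\<bar>if m \<in> F then c m else 0\<bar> \<le> (\<Sum>n\<in>F. \<bar>c n\<bar>)" for m
    using insert(1) member_le_sum[of m F "\<lambda>n. \<bar>c n\<bar>"] by (auto simp: sum_nonneg)
  have b2: "\<bar>c a * of_bool (m = a)\<bar> \<le> \<bar>c a\<bar>" for m by simp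
  have "(\<lambda>m. if m \<in> insert a F then c m else 0) = (\<lambda>m. (if m \<in> F then c m else 0) + c a * of_bool (m = a))"
    using insert(2) by (auto simp: fun_eq_iff)
  then have "act b \<gamma> (\<lambda>m. if m \<in> insert a F then c m else 0)
      = (\<Sum>n\<in>F. mass b \<gamma> n * c n) + act b \<gamma> (\<lambda>m. c a * of_bool (m = a))"
    by (simp only: act_add[OF \<gamma> b1 b2] insert.IH)
  also have "act b \<gamma> (\<lambda>m. c a * of_bool (m = a)) = c a * mass b \<gamma> a"
    unfolding mass_def by (rule act_cmult[OF \<gamma>, of _ 1]) simp
  finally show ?case using insert(1,2) by simp
qed

lemma finite_sum_abs_mass_le:
  assumes \<gamma>: "\<gamma> \<in> FD b" and F: "finite F"
  shows "(\<Sum>n\<in>F. \<bar>mass b \<gamma> n\<bar>) \<le> 2 * FN b \<gamma>"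
proof -
  have "(\<Sum>n\<in>F. \<bar>mass b \<gamma> n\<bar>) = act b \<gamma> (\<lambda>m. if m \<in> F then sgn (mass b \<gamma> m) else 0)"
    unfolding act_finite_support[OF \<gamma> F] by (simp add: abs_sgn)
  also have "\<dots> \<le> FN b \<gamma> * (2 * 1)"
    by (rule order_trans[OF abs_ge_self], rule abs_act_le[OF \<gamma>], rule bounded_imp_oscillation)
      (simp add: abs_sgn_eq)
  finally show ?thesis by simp
qed

lemma mass_summable:
  assumes \<gamma>: "\<gamma> \<in> FD b"
  shows "mass b \<gamma> summable_on UNIV"
proof -
  have "bdd_above (sum (\<lambda>n. norm (mass b \<gamma> n)) ` {F. F \<subseteq> UNIV \<and> finite F})"
    using finite_sum_abs_mass_le[OF \<gamma>] by (auto intro!: bdd_aboveI2)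
  then have "(\<lambda>n. norm (mass b \<gamma> n)) summable_on UNIV"
    by (intro nonneg_bdd_above_summable_on) auto
  then show ?thesis by (rule abs_summable_summable)
qed

lemma l1_mass_le:
  assumes \<gamma>: "\<gamma> \<in> FD b"
  shows "l1_on UNIV (mass b \<gamma>) \<le> 2 * FN b \<gamma>"
  unfolding l1_on_def
  by (rule infsum_le_finite_sums) (use abs_summable_on_subset[OF mass_summable[OF \<gamma>]] finite_sum_abs_mass_le[OF \<gamma>] in auto)

text \<open>
  Finite combinations of evaluations only see finitely many points. By approximation, an element of
  the free space is small on those functions bounded by 1 that vanish on a suitable finite set, whereas general elements of
  the dual need not be; this is what makes it an absolutely convergent combination of
  evaluations.
\<close>

lemma span_evaluation_finite_support:
  assumes "\<eta> \<in> span (evaluation M b ` mspace M)"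
  shows "\<exists>F. finite F \<and> (\<forall>f\<in>Lip0 M b. (\<forall>n\<in>F. f n = 0) \<longrightarrow> \<eta> f = 0)"
  using assms
proof (induction rule: span_induct_alt)
  case base
  then show ?case by (intro exI[of _ "{}"]) simp
next
  case (step c \<xi> \<eta>)
  then obtain p F where "\<xi> = evaluation M b p" "finite F"
    "\<forall>f\<in>Lip0 M b. (\<forall>n\<in>F. f n = 0) \<longrightarrow> \<eta> f = 0" by blast
  then show ?case
    by (intro exI[of _ "insert p F"]) (auto simp: evaluation_def scaleR_fun_def)
qed

lemma lipfree_tail_small:
  assumes \<gamma>: "\<gamma> \<in> FM b" and "0 < \<epsilon>"
  shows "\<exists>F. finite F \<and> (\<forall>f B. (\<forall>n. \<bar>f n\<bar> \<le> B) \<longrightarrow> (\<forall>n\<in>F. f n = 0) \<longrightarrow> \<bar>act b \<gamma> f\<bar> \<le> \<epsilon> * (2 * B))"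
proof -
  obtain \<eta> where \<eta>: "\<eta> \<in> span (evaluation antipodal_metric b ` UNIV)" "FN b (\<gamma> - \<eta>) < \<epsilon>"
    using \<gamma> \<open>0 < \<epsilon>\<close> unfolding lipfree_def by auto
  then obtain F where F: "finite F"
    "\<And>f. f \<in> Lip0 antipodal_metric b \<Longrightarrow> \<forall>n\<in>F. f n = 0 \<Longrightarrow> \<eta> f = 0"
    using span_evaluation_finite_support[of \<eta> antipodal_metric b] by auto
  have \<eta>D: "\<eta> \<in> FD b" using span_evaluation_subset_dual[of b antipodal_metric] \<eta>(1) by auto
  have d: "\<gamma> - \<eta> \<in> FD b" by (intro subspace_diff[OF subspace_dual_space] FM_FD \<gamma> \<eta>D)
  show ?thesis
  proof (intro exI[of _ "insert b F"] conjI allI impI)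
    fix f :: "int \<Rightarrow> real" and B assume B: "\<forall>n. \<bar>f n\<bar> \<le> B" and f: "\<forall>n\<in>insert b F. f n = 0"
    have osc: "\<bar>f m - f n\<bar> \<le> 2 * B" for m n by (rule bounded_imp_oscillation) (use B in auto)
    have "0 \<le> B" using B[rule_format, of 0] by linarith
    have "act b \<eta> f = 0"
      unfolding act_def by (rule F(2)) (use bounded_imp_Lip0[of f B b] B f in auto)
    then have "\<bar>act b \<gamma> f\<bar> = \<bar>act b (\<gamma> - \<eta>) f\<bar>" by (simp add: act_def)
    also have "\<dots> \<le> FN b (\<gamma> - \<eta>) * (2 * B)" by (rule abs_act_le[OF d osc])
    also have "\<dots> \<le> \<epsilon> * (2 * B)" using \<eta>(2) \<open>0 \<le> B\<close> by (intro mult_right_mono) auto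
    finally show "\<bar>act b \<gamma> f\<bar> \<le> \<epsilon> * (2 * B)" .
  qed (use F in auto)
qed

lemma act_eq_pairing:
  assumes \<gamma>: "\<gamma> \<in> FM b" and f: "\<And>n. \<bar>f n\<bar> \<le> B"
  shows "act b \<gamma> f = pairing (mass b \<gamma>) f"
proof -
  have "0 \<le> B" using f[of 0] by linarith
  have "((\<lambda>n. mass b \<gamma> n * f n) has_sum act b \<gamma> f) UNIV"
    unfolding has_sum_def
  proof (rule tendstoI)
    fix \<epsilon> :: real assume "0 < \<epsilon>"
    define e where "e = \<epsilon> / (2 * B + 1)"
    have "0 < e" unfolding e_def using \<open>0 < \<epsilon>\<close> \<open>0 \<le> B\<close> by simp
    have "e * (2 * B) < \<epsilon>"
      unfolding e_def using \<open>0 < \<epsilon>\<close> \<open>0 \<le> B\<close> by (simp add: field_simps)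
    obtain F where F: "finite F"
      "\<And>g. (\<forall>n. \<bar>g n\<bar> \<le> B) \<Longrightarrow> (\<forall>n\<in>F. g n = 0) \<Longrightarrow> \<bar>act b \<gamma> g\<bar> \<le> e * (2 * B)"
      using lipfree_tail_small[OF \<gamma> \<open>0 < e\<close>] by blast
    have "dist (\<Sum>n\<in>Y. mass b \<gamma> n * f n) (act b \<gamma> f) < \<epsilon>" if "finite Y" "F \<subseteq> Y" for Y
    proof -
      define g h where "g = (\<lambda>m. if m \<in> Y then f m else 0)" and "h = (\<lambda>m. if m \<in> Y then 0 else f m)"
      have g: "\<bar>g n\<bar> \<le> B" and h: "\<bar>h n\<bar> \<le> B" for n
        using f[of n] \<open>0 \<le> B\<close> by (auto simp: g_def h_def)
      have "f = (\<lambda>n. g n + h n)" by (auto simp: g_def h_def)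
      then have "act b \<gamma> f = act b \<gamma> g + act b \<gamma> h"
        using act_add[of \<gamma> b g B h B, OF FM_FD[OF \<gamma>] g h] by simp
      moreover have "act b \<gamma> g = (\<Sum>n\<in>Y. mass b \<gamma> n * f n)"
        unfolding g_def by (rule act_finite_support[OF FM_FD[OF \<gamma>] that(1)])
      moreover have "\<bar>act b \<gamma> h\<bar> \<le> e * (2 * B)"
        by (rule F(2)) (use h that(2) in \<open>auto simp: h_def\<close>)
      ultimately show ?thesis using \<open>e * (2 * B) < \<epsilon>\<close> by (simp add: dist_real_def)
    qed
    then show "\<forall>\<^sub>F Y in finite_subsets_at_top UNIV. dist (\<Sum>n\<in>Y. mass b \<gamma> n * f n) (act b \<gamma> f) < \<epsilon>"
      unfolding eventually_finite_subsets_at_top using F(1) by auto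
  qed
  then show ?thesis unfolding pairing_def by (simp add: infsumI)
qed

lemma pairing_mass_one:
  assumes \<gamma>: "\<gamma> \<in> FM b"
  shows "pairing (mass b \<gamma>) (\<lambda>_. 1) = 0"
proof -
  have "act b \<gamma> (\<lambda>_. 1) = \<gamma> 0" by (simp add: act_def zero_fun_def)
  also have "\<gamma> 0 = 0" using Lip0.dual_zero[OF FM_FD[OF \<gamma>]] .
  finally show ?thesis using act_eq_pairing[OF \<gamma>, of "\<lambda>_. 1" 1] by simp
qed

section \<open>The norm of the free space\<close>

lemma pairing_single: "pairing \<mu> (\<lambda>m. of_bool (m = n)) = \<mu> n"
proof -
  have "pairing \<mu> (\<lambda>m. of_bool (m = n)) = (\<Sum>\<^sub>\<infinity>m\<in>{n}. \<mu> m * of_bool (m = n))"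
    unfolding pairing_def by (rule infsum_cong_neutral) auto
  then show ?thesis by simp
qed

lemma pairing_shift:
  assumes \<mu>: "\<mu> summable_on UNIV" and 0: "pairing \<mu> (\<lambda>_. 1) = 0" and f: "\<And>n. \<bar>f n\<bar> \<le> B"
  shows "pairing \<mu> f = pairing \<mu> (\<lambda>n. f n - t)"
proof -
  have "\<bar>f n - t\<bar> \<le> B + \<bar>t\<bar>" for n using f[of n] by linarith
  then have "pairing \<mu> (\<lambda>n. (f n - t) + t * 1) = pairing \<mu> (\<lambda>n. f n - t) + pairing \<mu> (\<lambda>n. t * 1)"
    by (rule pairing_add_right[OF \<mu>, where C = "\<bar>t\<bar>"]) simp
  also have "pairing \<mu> (\<lambda>n. t * 1) = 0" by (simp only: pairing_cmult_right 0)
  finally show ?thesis by simp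
qed

text \<open>
  The extreme cases of a 1-Lipschitz function are those of oscillation at most 1, which see half the
  \<open>\<ell>\<^sub>1\<close>-norm of a vector of total mass 0, and those taking the values 1 and -1 at a pair \<open>p\<close>, \<open>-p\<close> and 0
  elsewhere. All others are, up to constants, convex combinations of these: if \<open>f p - f (- p) = 1 + s\<close>,
  then every other value lies within \<open>(1 - s) / 2\<close> of the midpoint of \<open>f p\<close> and \<open>f (- p)\<close>.
\<close>

lemma abs_pairing_antipodal_le:
  fixes \<mu> f :: "int \<Rightarrow> real"
  assumes \<mu>: "\<mu> summable_on UNIV" and 0: "pairing \<mu> (\<lambda>_. 1) = 0"
    and f: "\<And>m n. \<bar>f m - f n\<bar> \<le> antipodal_dist m n"
    and l1: "l1_on UNIV \<mu> / 2 \<le> K" and K: "\<And>n. \<bar>\<mu> n - \<mu> (- n)\<bar> \<le> K"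
  shows "\<bar>pairing \<mu> f\<bar> \<le> K"
proof -
  have fB: "\<bar>f n\<bar> \<le> 2 + \<bar>f 0\<bar>" for n
    using f[of n 0] antipodal_dist_le_2[of n 0] by linarith
  show ?thesis
  proof (cases "\<forall>m n. \<bar>f m - f n\<bar> \<le> 1")
    case True
    define t where "t = (INF n. f n) + 1/2"
    have lower: "(INF n. f n) \<le> f n" for n
    proof (rule cINF_lower)
      show "bdd_below (range f)" 
      proof (rule bdd_belowI2)
        show "- (2 + \<bar>f 0\<bar>) \<le> f n" for n using fB[of n] by linarith
      qed
    qed simp
    have upper: "f n - 1 \<le> (INF m. f m)" for n
    proof (rule cINF_greatest)
      show "f n - 1 \<le> f m" for m using True[rule_format, of n m] by linarith
    qed simp
    have "\<bar>f n - t\<bar> \<le> 1/2" for n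
      using lower[of n] upper[of n] unfolding t_def by linarith
    then have "\<bar>pairing \<mu> (\<lambda>n. f n - t)\<bar> \<le> 1/2 * l1_on UNIV \<mu>"
      by (rule abs_pairing_le[OF \<mu>]) simp
    with pairing_shift[OF \<mu> 0, of f "2 + \<bar>f 0\<bar>" t, OF fB] l1 show ?thesis by simp
  next
    case False
    then obtain p q where "1 < \<bar>f p - f q\<bar>" by (auto simp: not_le)
    then have "1 < f p - f q \<or> 1 < f q - f p" by linarith
    then obtain p q where pq: "1 < f p - f q" by blast
    have "p = - q" "p \<noteq> q" "f p - f q \<le> 2"
      using f[of p q] pq by (auto simp: antipodal_dist_def split: if_splits)
    then have q: "q = - p" and "p \<noteq> - p" by auto
    define s where "s = f p - f q - 1"
    have s: "0 < s" "s \<le> 1" using pq \<open>f p - f q \<le> 2\<close> by (auto simp: s_def)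
    define t where "t = (f p + f q) / 2"
    define e where "e = (\<lambda>n. of_bool (n = p) - of_bool (n = - p) :: real)"
    define h where "h n = (f n - t) - s * e n" for n
    \<comment> \<open>After recentring, \<open>f\<close> is \<open>s\<close> times the extremal function of the pair plus a function of oscillation \<open>1 - s\<close>.\<close>
    have h: "\<bar>h n\<bar> \<le> (1 - s) / 2" for n
    proof -
      consider "n = p" | "n = - p" | "n \<noteq> p" "n \<noteq> - p" by blast
      then show ?thesis
      proof cases
        case 1
        then show ?thesis using \<open>p \<noteq> - p\<close> s unfolding h_def e_def t_def s_def by (simp add: field_simps)
      next
        case 2
        then show ?thesis using \<open>p \<noteq> - p\<close> s q unfolding h_def e_def t_def s_def by (simp add: field_simps)
      next
        case 3
        then have "\<bar>f n - f p\<bar> \<le> 1" "\<bar>f n - f q\<bar> \<le> 1"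
          using f[of n p] f[of n q] q by (auto simp: antipodal_dist_def)
        then have "f p - 1 \<le> f n" "f n \<le> f q + 1" by linarith+
        moreover have "h n = f n - t" using 3 by (simp add: h_def e_def)
        ultimately have "h n \<le> (1 - s) / 2" "- h n \<le> (1 - s) / 2"
          unfolding t_def s_def by (simp_all add: field_simps)
        then show ?thesis by (rule abs_leI)
      qed
    qed
    have eB: "\<bar>e n\<bar> \<le> 1" for n by (simp add: e_def)
    have "pairing \<mu> (\<lambda>n. of_bool (n = p) + (- 1) * of_bool (n = - p)) =
        pairing \<mu> (\<lambda>n. of_bool (n = p)) + pairing \<mu> (\<lambda>n. (- 1) * of_bool (n = - p))"
      by (rule pairing_add_right[OF \<mu>, of _ 1 _ 1]) auto
    then have pe: "pairing \<mu> e = \<mu> p - \<mu> (- p)"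
      unfolding pairing_cmult_right pairing_single e_def by simp
    have "pairing \<mu> f = pairing \<mu> (\<lambda>n. h n + s * e n)"
      using pairing_shift[OF \<mu> 0, of f "2 + \<bar>f 0\<bar>" t, OF fB] by (simp add: h_def)
    also have "\<dots> = pairing \<mu> h + pairing \<mu> (\<lambda>n. s * e n)"
      by (rule pairing_add_right[OF \<mu> h, of _ s]) (use eB s in \<open>simp add: abs_mult mult_left_le\<close>)
    also have "\<dots> = pairing \<mu> h + s * (\<mu> p - \<mu> (- p))"
      by (simp only: pairing_cmult_right pe)
    finally have "\<bar>pairing \<mu> f\<bar> \<le> \<bar>pairing \<mu> h\<bar> + s * \<bar>\<mu> p - \<mu> (- p)\<bar>"
      using s by (simp add: abs_mult order_trans[OF abs_triangle_ineq])
    also have "\<dots> \<le> (1 - s) / 2 * l1_on UNIV \<mu> + s * K"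
      by (intro add_mono mult_left_mono K abs_pairing_le[OF \<mu> h]) (use s in auto)
    also have "\<dots> \<le> (1 - s) * K + s * K"
      using mult_left_mono[OF l1, of "1 - s"] s by simp
    finally show ?thesis by (simp add: algebra_simps)
  qed
qed

lemma lipfree_norm_le:
  assumes \<gamma>: "\<gamma> \<in> FM b"
    and l1: "l1_on UNIV (mass b \<gamma>) / 2 \<le> K" and K: "\<And>n. \<bar>mass b \<gamma> n - mass b \<gamma> (- n)\<bar> \<le> K"
  shows "FN b \<gamma> \<le> K"
  unfolding lipfree_norm_def
proof (rule Lip0.dual_norm_least)
  fix f assume f: "f \<in> Lip0 antipodal_metric b" "lip_norm antipodal_metric f \<le> 1"
  have lip: "\<bar>f m - f n\<bar> \<le> antipodal_dist m n" for m n
  proof -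
    have "lip_norm antipodal_metric f * antipodal_dist m n \<le> 1 * antipodal_dist m n"
      using f(2) by (rule mult_right_mono) (simp add: antipodal_dist_def)
    with lip_norm_bound[OF f(1), of m n] show ?thesis by simp
  qed
  have fb: "f b = 0" using f(1) by (simp add: Lip0_iff)
  have "\<bar>f n\<bar> \<le> 2" for n
    using lip[of n b] antipodal_dist_le_2[of n b] fb by simp
  then have "\<gamma> f = pairing (mass b \<gamma>) f"
    using act_eq_pairing[OF \<gamma>, of f 2] fb by (simp add: act_def)
  also have "\<bar>\<dots>\<bar> \<le> K"
    by (rule abs_pairing_antipodal_le[OF mass_summable[OF FM_FD[OF \<gamma>]] pairing_mass_one[OF \<gamma>] lip l1 K])
  finally show "\<bar>\<gamma> f\<bar> \<le> K" .
qed

lemma lipfree_norm_le_l1: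
  assumes \<gamma>: "\<gamma> \<in> FM b"
  shows "FN b \<gamma> \<le> l1_on UNIV (mass b \<gamma>)"
proof (rule lipfree_norm_le[OF \<gamma>])
  let ?c = "mass b \<gamma>"
  show "l1_on UNIV ?c / 2 \<le> l1_on UNIV ?c" using l1_on_nonneg[of UNIV ?c] by simp
  show "\<bar>?c n - ?c (- n)\<bar> \<le> l1_on UNIV ?c" for n
  proof (cases "n = - n")
    case True
    then show ?thesis using l1_on_nonneg[of UNIV ?c] by simp
  next
    case False
    then show ?thesis
      using abs_add_abs_le_l1_on[OF mass_summable[OF FM_FD[OF \<gamma>]], of n UNIV "- n"] by simp
  qed
qed

section \<open>Schur properties of the free space\<close>

lemma lipfree_norm_diff_le:
  assumes "\<And>n. x n \<in> FM b" "\<And>n. FN b (x n) \<le> B"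
  shows "FN b (x i - x j) \<le> 2 * B"
proof -
  have "- x j = (-1) *\<^sub>R x j" by simp
  then have "FN b (- x j) = FN b (x j)" using FM.scale[OF assms(1)[of j], of "-1"] by simp
  moreover have "FN b (x i + - x j) \<le> FN b (x i) + FN b (- x j)"
    by (intro lipfree_norm_add FM_FD subspace_neg[OF FM.subsp] assms)
  ultimately show ?thesis using assms(2)[of i] assms(2)[of j] by simp
qed

lemma act_diff: "act b (\<gamma> - \<eta>) f = act b \<gamma> f - act b \<eta> f"
  by (simp add: act_def)

text \<open>
  The norm lies between \<open>l1_on UNIV \<mu> / 2\<close> and \<open>l1_on UNIV \<mu>\<close>, where \<open>\<mu>\<close> is the family of masses;
  applying \<open>l1_Schur\<close> to the differences of far terms that witness \<open>ca\<close> loses exactly this factor 2.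
\<close>

lemma lipfree_2_Schur: "Schur_property (FM b) (FN b) 2"
  unfolding Schur_property_def
proof (intro allI impI, elim conjE exE)
  fix x :: "nat \<Rightarrow> (int \<Rightarrow> real) \<Rightarrow> real" and B assume x': "\<forall>n. x n \<in> FM b" and B': "\<forall>n. FN b (x n) \<le> B"
  then have x: "x n \<in> FM b" and B: "FN b (x n) \<le> B" for n by auto
  have diff: "x i - x j \<in> FM b" for i j by (intro subspace_diff[OF FM.subsp] x)
  have bd: "FN b (x i - x j) \<le> 2 * B" for i j by (rule lipfree_norm_diff_le[OF x B])
  let ?W = "weak_ca (FM b) (FN b) x"
  show "ca (\<lambda>u v. FN b (u - v)) x \<le> 2 * ?W"
  proof (rule dense_le)
    fix c assume c: "c < ca (\<lambda>u v. FN b (u - v)) x"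
    have "\<exists>i\<ge>n. \<exists>j\<ge>n. c < FN b (x i - x j)" for n
      using less_caD[of "\<lambda>u v. FN b (u - v)" x "2 * B" c n, OF bd _ c] FM.nonneg[OF diff] by blast
    then obtain p q where pq: "\<And>n. n \<le> p n" "\<And>n. n \<le> q n" "\<And>n. c < FN b (x (p n) - x (q n))"
      by metis
    define w where "w n = mass b (x (p n) - x (q n))" for n
    have ws: "w n summable_on UNIV" for n
      unfolding w_def by (rule mass_summable[OF FM_FD[OF diff]])
    have wB: "l1_on UNIV (w n) \<le> 4 * B" for n
      using l1_mass_le[OF FM_FD[OF diff], of "p n" "q n"] bd[of "p n" "q n"] by (simp add: w_def)
    have wc: "c \<le> l1_on UNIV (w n)" for n
      using lipfree_norm_le_l1[OF diff, of "p n" "q n"] pq(3)[of n] by (simp add: w_def)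
    show "c \<le> 2 * ?W"
    proof (rule field_le_epsilon)
      fix e :: real assume "0 < e"
      then have "0 < e / 2" by simp
      then obtain f r where f: "\<And>n. \<bar>f n\<bar> \<le> 1 / 2" and r: "strict_mono (r :: nat \<Rightarrow> nat)"
        and wf: "\<And>k. c / 2 - e / 2 \<le> pairing (w (r k)) f"
        by (rule l1_Schur[of w "4 * B" c "e / 2", OF ws wB wc]) blast
      let ?g = "\<lambda>n. f n - f b"
      have osc: "\<bar>f m - f n\<bar> \<le> 1" for m n using bounded_imp_oscillation[of f "1 / 2" m n, OF f] by simp
      have g: "?g \<in> Lip0 antipodal_metric b" "lip_norm antipodal_metric ?g \<le> 1"
        by (rule bounded_oscillation_imp_Lip0, rule osc)+
      have "c / 2 - e / 2 \<le> ca dist (\<lambda>n. x n ?g)"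
      proof (rule ca_ge)
        show "dist (x i ?g) (x j ?g) \<le> 2 * B" for i j
          using abs_le_lipfree_norm[OF FM_FD[OF diff] g, of i j] bd[of i j] by (simp add: dist_real_def)
        fix n
        let ?i = "p (r n)" and ?j = "q (r n)"
        have "pairing (w (r n)) f = act b (x ?i - x ?j) f"
          unfolding w_def by (rule act_eq_pairing[OF diff f, symmetric])
        also have "\<dots> \<le> dist (x ?i ?g) (x ?j ?g)"
          unfolding act_diff by (simp add: act_def dist_real_def)
        finally have "c / 2 - e / 2 \<le> dist (x ?i ?g) (x ?j ?g)" using wf[of n] by linarith
        moreover have "n \<le> ?i" "n \<le> ?j"
          using pq(1,2)[of "r n"] strict_mono_imp_increasing[OF r, of n] by linarith+
        ultimately show "\<exists>i\<ge>n. \<exists>j\<ge>n. c / 2 - e / 2 \<le> dist (x i ?g) (x j ?g)" by blast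
      qed
      also have "\<dots> \<le> ?W"
        by (rule lipfree_ca_le_weak_ca[OF _ g x B]) simp
      finally show "c \<le> 2 * ?W + e" by simp
    qed
  qed
qed

text \<open>
  Let \<open>x (r j)\<close> have the masses \<open>u + y j\<close> with almost disjoint \<open>y j\<close> of norm about \<open>a\<close>. Differences of
  two terms have norm at most about \<open>a\<close>: half the \<open>\<ell>\<^sub>1\<close>-norm of \<open>y i - y j\<close> is about \<open>a\<close>, and since the
  blocks are symmetric a pair \<open>{n, -n}\<close> meets at most one of them. So \<open>\<delta> \<le> a\<close> up to the error, while half
  the \<open>\<ell>\<^sub>1\<close>-norm bounds linear combinations from below with constant \<open>a / 2\<close>.
\<close>

lemma lipfree_1_strong_Schur: "one_strong_Schur_property (FM b) (FN b)"
  unfolding one_strong_Schur_property_def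
proof (intro allI impI, elim conjE)
  fix \<delta> \<epsilon> :: real and x :: "nat \<Rightarrow> (int \<Rightarrow> real) \<Rightarrow> real"
  assume \<delta>: "0 < \<delta>" "\<delta> \<le> 2" and \<epsilon>: "0 < \<epsilon>" and x': "\<forall>n. x n \<in> FM b \<and> FN b (x n) = 1"
    and sep: "\<forall>n m. n \<noteq> m \<longrightarrow> \<delta> \<le> FN b (x n - x m)"
  have x: "x n \<in> FM b" and N: "FN b (x n) = 1" for n using x' by auto
  \<comment> \<open>The lower estimate below loses \<open>3 * e\<close> from the ideal constant \<open>\<delta> / 2\<close>.\<close>
  define e where "e = (\<delta> / 2 - 1 / (2 / \<delta> + \<epsilon>)) / 3"
  have e: "0 < e"
  proof -
    have "1 / (2 / \<delta> + \<epsilon>) < 1 / (2 / \<delta>)" using \<delta> \<epsilon> by (intro divide_strict_left_mono mult_pos_pos add_pos_pos) auto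
    then show ?thesis unfolding e_def by simp
  qed
  let ?c = "\<lambda>n. mass b (x n)"
  have cs: "?c n summable_on UNIV" for n by (rule mass_summable[OF FM_FD[OF x]])
  have cB: "l1_on UNIV (?c n) \<le> 2" for n using l1_mass_le[OF FM_FD[OF x], of n] N[of n] by simp
  obtain r u F0 G a where r: "strict_mono (r :: nat \<Rightarrow> nat)" and u: "u summable_on UNIV"
    and F0: "l1_on (- F0) u \<le> e"
    and GF: "\<And>j. G j \<inter> F0 = {}" and G: "disjoint_family G"
    and Gsym: "\<And>j n. n \<in> G j \<Longrightarrow> - n \<in> G j"
    and yG': "\<And>j. l1_on (- G (j::nat)) (\<lambda>n. ?c (r j) n - u n) \<le> e"
    and ya': "\<And>j. \<bar>l1_on UNIV (\<lambda>n. ?c (r j) n - u n) - a\<bar> \<le> e"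
    by (rule gliding_hump[of ?c 2 e, OF cs cB e]) blast
  define y where "y = (\<lambda>j n. ?c (r j) n - u n)"
  have ys: "y j summable_on UNIV" for j
    unfolding y_def
    using summable_on_add[OF cs[of "r j"] summable_on_uminus[THEN iffD2, OF u]] by simp
  have yG: "l1_on (- G j) (y j) \<le> e" for j using yG'[of j] by (simp add: y_def)
  have ya: "l1_on UNIV (y j) \<le> a + e" "a - e \<le> l1_on UNIV (y j)" for j
    using ya'[of j] by (auto simp: y_def abs_le_iff)
  have two: "\<bar>y j n - y j (- n)\<bar> \<le> l1_on S (y j)" if "n \<in> S" "- n \<in> S" for j n S
  proof (cases "n = - n")
    case True
    then show ?thesis using l1_on_nonneg[of S "y j"] by simp
  next
    case False
    then show ?thesis using abs_add_abs_le_l1_on[OF ys that, of j] by simp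
  qed
  have \<delta>a: "\<delta> \<le> a + 2 * e"
  proof -
    have "r 0 \<noteq> r 1" using strict_monoD[OF r, of 0 1] by simp
    then have "\<delta> \<le> FN b (x (r 0) - x (r 1))" using sep by blast
    also have "\<dots> \<le> a + 2 * e"
    proof (rule lipfree_norm_le)
      have m: "mass b (x (r 0) - x (r 1)) = (\<lambda>n. y 0 n - y 1 n)"
        by (simp add: mass_def act_diff y_def fun_eq_iff)
      show "x (r 0) - x (r 1) \<in> FM b" by (intro subspace_diff[OF FM.subsp] x)
      show "l1_on UNIV (mass b (x (r 0) - x (r 1))) / 2 \<le> a + 2 * e"
        unfolding m using l1_on_diff_le[OF ys ys, of UNIV 0 1] ya(1)[of 0] ya(1)[of 1] e by simp
      show "\<bar>mass b (x (r 0) - x (r 1)) n - mass b (x (r 0) - x (r 1)) (- n)\<bar> \<le> a + 2 * e" for n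
      proof -
        have "\<bar>y 0 n - y 0 (- n)\<bar> + \<bar>y 1 n - y 1 (- n)\<bar> \<le> a + 2 * e"
        proof (cases "n \<in> G 0")
          case True
          then have "n \<in> - G 1" "- n \<in> - G 1" using Gsym[of n 0] G[THEN disjoint_family_onD, of 0 1] by auto
          then show ?thesis
            using two[of n UNIV 0] two[of n "- G 1" 1] ya(1)[of 0] yG[of 1] by simp
        next
          case False
          then have "n \<in> - G 0" "- n \<in> - G 0" using Gsym[of "- n" 0] by auto
          then show ?thesis
            using two[of n UNIV 1] two[of n "- G 0" 0] ya(1)[of 1] yG[of 0] by simp
        qed
        then show ?thesis unfolding m by linarith
      qed
    qed
    finally show ?thesis .
  qed
  show "\<exists>r. strict_mono r \<and> equivalent_to_l1_basis (FN b) (2 / \<delta> + \<epsilon>) (\<lambda>j. x (r j))"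
    unfolding equivalent_to_l1_basis_def
  proof (intro exI[of _ r] conjI allI r N)
    fix m :: nat and \<alpha> :: "nat \<Rightarrow> real"
    have v: "\<bar>sgn (\<alpha> j) * sgn (y j n)\<bar> \<le> 1" for j n by (simp add: abs_mult abs_sgn_eq)
    have w: "\<bar>0::real\<bar> \<le> 1" by simp
    obtain f where "\<forall>n. \<bar>f n\<bar> \<le> 1 / 2" "\<forall>j. \<forall>n\<in>G j. f n = sgn (\<alpha> j) * sgn (y j n) / 2"
      "\<forall>n\<in>F0. f n = 0 / 2"
      using sign_pattern[of G F0 "\<lambda>j n. sgn (\<alpha> j) * sgn (y j n)" "\<lambda>_. 0", OF G GF v w] by blast
    then have f: "\<And>n. \<bar>f n\<bar> \<le> 1 / 2"
      and fG: "\<And>j n. n \<in> G j \<Longrightarrow> f n = sgn (\<alpha> j) * sgn (y j n) / 2"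
      and fF: "\<And>n. n \<in> F0 \<Longrightarrow> f n = 0" by auto
    have uf: "\<bar>pairing u f\<bar> \<le> e / 2"
      using abs_pairing_le[OF u, of f "1 / 2" "- F0", OF f] fF F0 by simp
    have summand: "(\<delta> / 2 - 3 * e) * \<bar>\<alpha> j\<bar> \<le> \<alpha> j * act b (x (r j)) f" for j
    proof (cases "\<alpha> j = 0")
      case False
      have "act b (x (r j)) f = pairing (\<lambda>n. u n + y j n) f"
        using act_eq_pairing[OF x f] by (simp add: y_def)
      also have "\<dots> = pairing u f + pairing (y j) f" by (rule pairing_add_left[OF u ys, where B = "1 / 2", OF f])
      finally have s: "\<alpha> j * act b (x (r j)) f = \<alpha> j * pairing u f + \<alpha> j * pairing (y j) f"
        by (simp add: distrib_left)
      have "\<bar>\<alpha> j\<bar> * \<bar>pairing u f\<bar> \<le> \<bar>\<alpha> j\<bar> * (e / 2)" using uf by (rule mult_left_mono) simp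
      then have 1: "- (\<bar>\<alpha> j\<bar> * (e / 2)) \<le> \<alpha> j * pairing u f"
        unfolding abs_mult[symmetric] by linarith
      have "l1_on UNIV (y j) / 2 - l1_on (- G j) (y j) \<le> pairing (y j) (\<lambda>n. sgn (\<alpha> j) * f n)"
      proof (rule pairing_ge_half_l1[OF ys])
        show "\<bar>sgn (\<alpha> j) * f n\<bar> \<le> 1 / 2" for n using False f[of n] by (simp add: abs_mult abs_sgn_eq)
        show "sgn (\<alpha> j) * f n = sgn (y j n) / 2" if "n \<in> G j" for n
          using False fG[OF that] by (cases "0 < \<alpha> j") auto
      qed
      then have "(a - e) / 2 - e \<le> sgn (\<alpha> j) * pairing (y j) f"
        using ya(2)[of j] yG[of j] unfolding pairing_cmult_right diff_divide_distrib by linarith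
      then have "\<bar>\<alpha> j\<bar> * ((a - e) / 2 - e) \<le> \<bar>\<alpha> j\<bar> * (sgn (\<alpha> j) * pairing (y j) f)"
        by (rule mult_left_mono) simp
      also have "\<dots> = \<alpha> j * pairing (y j) f" by (simp add: abs_mult_sgn flip: mult.assoc)
      finally have "\<bar>\<alpha> j\<bar> * ((a - e) / 2 - e) - \<bar>\<alpha> j\<bar> * (e / 2) \<le> \<alpha> j * act b (x (r j)) f"
        unfolding s using 1 by linarith
      moreover have "\<bar>\<alpha> j\<bar> * (\<delta> / 2 - 3 * e) \<le> \<bar>\<alpha> j\<bar> * ((a - e) / 2 - e - e / 2)"
        using \<delta>a by (intro mult_left_mono) (auto simp: field_simps)
      ultimately show ?thesis by (simp add: algebra_simps)
    qed simp
    let ?s = "\<Sum>j<m. \<alpha> j *\<^sub>R x (r j)"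
    have sD: "?s \<in> FD b"
      by (intro FM_FD subspace_sum[OF FM.subsp] subspace_mul[OF FM.subsp] x)
    have act_sum: "act b (\<Sum>j<k. \<alpha> j *\<^sub>R x (r j)) f = (\<Sum>j<k. \<alpha> j * act b (x (r j)) f)" for k
      by (induction k) (simp_all add: act_def scaleR_fun_def)
    have osc: "\<bar>f m - f n\<bar> \<le> 1" for m n using bounded_imp_oscillation[of f "1 / 2" m n, OF f] by simp
    have "1 / (2 / \<delta> + \<epsilon>) = \<delta> / 2 - 3 * e"
    proof -
      have "3 * (t / 3) = t" for t :: real by simp
      then show ?thesis unfolding e_def by (simp only: diff_diff_eq2 add_diff_cancel_left')
    qed
    then have "1 / (2 / \<delta> + \<epsilon>) * (\<Sum>j<m. \<bar>\<alpha> j\<bar>) = (\<Sum>j<m. (\<delta> / 2 - 3 * e) * \<bar>\<alpha> j\<bar>)"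
      by (simp only: sum_distrib_left)
    also have "\<dots> \<le> act b ?s f"
      unfolding act_sum by (rule sum_mono) (rule summand)
    also have "\<dots> \<le> FN b ?s"
      using abs_act_le[OF sD, of f 1, OF osc] by simp
    finally show "1 / (2 / \<delta> + \<epsilon>) * (\<Sum>j<m. \<bar>\<alpha> j\<bar>) \<le> FN b ?s" .
  qed
qed

text \<open>
  The enumeration \<open>1, -1, 2, -2, \<dots>\<close> of the nonzero integers.
\<close>

definition antipodal_seq :: "nat \<Rightarrow> int"
  where "antipodal_seq n = (if even n then 1 else - 1) * (int (n div 2) + 1)"

lemma inj_antipodal_seq: "inj antipodal_seq"
proof (rule injI)
  fix m n assume eq: "antipodal_seq m = antipodal_seq n"
  have "even m = even n"
    using eq by (auto simp: antipodal_seq_def split: if_splits)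
  moreover from this have "m div 2 = n div 2"
    using eq by (auto simp: antipodal_seq_def split: if_splits)
  ultimately show "m = n" by (metis dvd_imp_mod_0 div_mult_mod_eq odd_iff_mod_2_eq_one)
qed

lemma antipodal_seq_facts: "antipodal_seq (2 * n + 1) = - antipodal_seq (2 * n)" "antipodal_seq n \<noteq> 0"
  by (auto simp: antipodal_seq_def)

text \<open>
  Along an injective sequence of points, a 1-Lipschitz function oscillates by more than 1 at most
  once: a pair with a larger gap forces all other values into a short interval.
\<close>

lemma ca_antipodal_le_1:
  fixes t :: "nat \<Rightarrow> real"
  assumes s: "inj s" and t: "\<And>i j. \<bar>t i - t j\<bar> \<le> antipodal_dist (s i) (s j)"
  shows "ca dist t \<le> 1"
proof -
  have B: "dist (t i) (t j) \<le> 2" for i j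
    using t[of i j] antipodal_dist_le_2[of "s i" "s j"] by (simp add: dist_real_def)
  show ?thesis
  proof (cases "\<forall>i j. \<bar>t i - t j\<bar> \<le> 1")
    case True
    then show ?thesis by (intro ca_le[where d = dist and B = 2 and n = 0]) (use B in \<open>auto simp: dist_real_def\<close>)
  next
    case False
    then obtain p q where "1 < \<bar>t p - t q\<bar>" by (auto simp: not_le)
    then have "1 < t p - t q \<or> 1 < t q - t p" by linarith
    then obtain p q where pq: "1 < t p - t q" by blast
    then have sq: "s p = - s q"
      using t[of p q] by (auto simp: antipodal_dist_def split: if_splits)
    \<comment> \<open>All later values lie in \<open>[t p - 1, t q + 1]\<close>, an interval of length less than 1.\<close>
    have later: "t p - 1 \<le> t i \<and> t i \<le> t q + 1" if "p < i" "q < i" for i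
    proof -
      have "s i \<noteq> s p" "s i \<noteq> s q" using that injD[OF s] by blast+
      then have "antipodal_dist (s i) (s p) = 1" "antipodal_dist (s i) (s q) = 1"
        using sq by (auto simp: antipodal_dist_def)
      then show ?thesis using t[of i p] t[of i q] by (auto simp: abs_le_iff)
    qed
    show ?thesis
    proof (rule ca_le[where d = dist and B = 2 and n = "Suc (max p q)"])
      fix i j assume "Suc (max p q) \<le> i" "Suc (max p q) \<le> j"
      then show "dist (t i) (t j) \<le> 1"
        using later[of i] later[of j] pq unfolding dist_real_def by linarith
    qed (use B in auto)
  qed
qed

text \<open>
  The evaluations at \<open>1, -1, 2, -2, \<dots>\<close> have \<open>ca\<close> at least 2 by the opposite pairs and \<open>weak_ca\<close> at
  most 1.
\<close>

lemma lipfree_not_Schur: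
  assumes c: "c < 2"
  shows "\<not> Schur_property (FM b) (FN b) c"
proof
  assume Schur: "Schur_property (FM b) (FN b) c"
  let ?ev = "evaluation antipodal_metric b"
  define x where "x n = ?ev (antipodal_seq n)" for n
  have ev: "?ev p \<in> FM b" for p
    using span_evaluation_subset_lipfree[of b antipodal_metric] by (auto intro: span_base)
  have x: "x n \<in> FM b" for n by (simp add: x_def ev)
  have diff: "x i - x j \<in> FM b" for i j by (intro subspace_diff[OF FM.subsp] x)
  have le: "FN b (?ev p - ?ev q) \<le> antipodal_dist p q" for p q
    unfolding lipfree_norm_def
  proof (rule Lip0.dual_norm_least)
    fix f assume f: "f \<in> Lip0 antipodal_metric b" "lip_norm antipodal_metric f \<le> 1"
    have "lip_norm antipodal_metric f * antipodal_dist p q \<le> 1 * antipodal_dist p q"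
      using f(2) by (rule mult_right_mono) (simp add: antipodal_dist_def)
    with lip_norm_bound[OF f(1), of p q] f(1) show "\<bar>(?ev p - ?ev q) f\<bar> \<le> antipodal_dist p q"
      by (simp add: evaluation_def)
  qed
  have N: "FN b (x n) \<le> 2" for n
  proof -
    \<comment> \<open>The evaluation at the base point is 0.\<close>
    have "x n = ?ev (antipodal_seq n) - ?ev b"
      by (auto simp: x_def evaluation_def fun_eq_iff Lip0_iff)
    then show ?thesis
      using le[of "antipodal_seq n" b] antipodal_dist_le_2[of "antipodal_seq n" b] by simp
  qed
  have "2 \<le> ca (\<lambda>u v. FN b (u - v)) x"
  proof (rule ca_ge)
    show "FN b (x i - x j) \<le> 2 * 2" for i j by (rule lipfree_norm_diff_le[OF x N])
    fix n
    define p where "p = antipodal_seq (2 * n)"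
    have p: "p \<noteq> 0" "p \<noteq> - p" using antipodal_seq_facts(2)[of "2 * n"] by (auto simp: p_def)
    define f where "f m = (of_bool (m = p) - of_bool (m = - p) :: real)" for m
    let ?g = "\<lambda>m. f m - f b"
    have lip: "\<bar>f m - f k\<bar> \<le> 1 * antipodal_dist m k" for m k
      using p by (auto simp: f_def antipodal_dist_def)
    have g: "?g \<in> Lip0 antipodal_metric b" "lip_norm antipodal_metric ?g \<le> 1"
      using lip by (auto simp: Lip0_iff intro!: exI[of _ 1] lip_norm_le)
    have "2 = \<bar>(x (2 * n) - x (2 * n + 1)) ?g\<bar>"
      using g(1) p(2) unfolding x_def antipodal_seq_facts p_def[symmetric]
      by (simp add: evaluation_def f_def)
    also have "\<dots> \<le> FN b (x (2 * n) - x (2 * n + 1))"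
      by (rule abs_le_lipfree_norm[OF FM_FD[OF diff] g])
    finally show "\<exists>i\<ge>n. \<exists>j\<ge>n. 2 \<le> FN b (x i - x j)"
      by (intro exI[of _ "2 * n"] exI[of _ "2 * n + 1"] conjI) auto
  qed
  moreover have "ca (\<lambda>u v. FN b (u - v)) x \<le> c * weak_ca (FM b) (FN b) x"
    using Schur x N unfolding Schur_property_def by blast
  moreover have "weak_ca (FM b) (FN b) x \<le> 1"
  proof (rule FM.weak_ca_least)
    fix \<phi> assume \<phi>: "\<phi> \<in> dual_space (FM b) (FN b)" "dual_norm (FM b) (FN b) \<phi> \<le> 1"
    show "ca dist (\<lambda>n. \<phi> (x n)) \<le> 1"
    proof (rule ca_antipodal_le_1[OF inj_antipodal_seq])
      fix i j
      have "\<bar>\<phi> (x i) - \<phi> (x j)\<bar> = \<bar>\<phi> (x i - x j)\<bar>" by (simp only: FM.dual_diff[OF \<phi>(1) x x])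
      also have "\<dots> \<le> dual_norm (FM b) (FN b) \<phi> * FN b (x i - x j)"
        by (rule FM.dual_norm_bound[OF \<phi>(1) diff])
      also have "\<dots> \<le> 1 * FN b (x i - x j)"
        using \<phi>(2) FM.nonneg[OF diff] by (rule mult_right_mono)
      also have "\<dots> \<le> antipodal_dist (antipodal_seq i) (antipodal_seq j)"
        unfolding x_def using le by simp
      finally show "\<bar>\<phi> (x i) - \<phi> (x j)\<bar> \<le> antipodal_dist (antipodal_seq i) (antipodal_seq j)" .
    qed
  qed
  moreover have "0 \<le> weak_ca (FM b) (FN b) x" by (rule FM.weak_ca_nonneg[OF x N])
  moreover have "c * w < 2" if "0 \<le> w" "w \<le> 1" for w :: real
  proof (cases "0 \<le> c")
    case True
    then show ?thesis using mult_left_mono[OF that(2) True] c by simp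
  next
    case False
    then show ?thesis using that(1) mult_nonpos_nonneg[of c w] by simp
  qed
  ultimately show False by force
qed

theorem mainTheorem13:
  shows "\<exists>M :: int metric.
     mspace M = UNIV \<and> is_graph_metric M \<and>
     one_separated M \<and>
     bdd_above (range (\<lambda>(x, y). mdist M x y)) \<and> diam_wrt (mdist M) (mspace M) = 2 \<and>
     (\<forall>b\<in>mspace M.
        Schur_property (lipfree M b) (lipfree_norm M b) 2 \<and>
        (\<forall>c<2. \<not> Schur_property (lipfree M b) (lipfree_norm M b) c) \<and>
        one_strong_Schur_property (lipfree M b) (lipfree_norm M b))"
proof (intro exI[of _ antipodal_metric] conjI ballI allI impI)
  show "mspace antipodal_metric = UNIV" by simp
  show "is_graph_metric antipodal_metric" by (rule is_graph_metric_antipodal)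
  show "one_separated antipodal_metric" by (simp add: one_separated_def antipodal_dist_def)
  show bdd: "bdd_above (range (\<lambda>(x, y). mdist antipodal_metric x y))"
    by (auto intro!: bdd_aboveI2[of _ _ 2] simp: antipodal_dist_le_2)
  show "diam_wrt (mdist antipodal_metric) (mspace antipodal_metric) = 2"
  proof (rule antisym)
    show "diam_wrt (mdist antipodal_metric) (mspace antipodal_metric) \<le> 2"
      by (auto simp: diam_wrt_def antipodal_dist_le_2 intro!: cSUP_least)
    have "2 = antipodal_dist 1 (- 1)" by (simp add: antipodal_dist_def)
    also have "\<dots> \<le> (SUP (x, y)\<in>UNIV \<times> UNIV. antipodal_dist x y)"
      using bdd by (intro cSUP_upper2[of _ _ "(1, - 1)"]) auto
    finally show "2 \<le> diam_wrt (mdist antipodal_metric) (mspace antipodal_metric)"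
      by (simp add: diam_wrt_def)
  qed
qed (rule lipfree_2_Schur lipfree_not_Schur lipfree_1_strong_Schur; assumption?)+

end
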